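(* Let $(W,I)$ be an irreducible finite Coxeter group of type $F_4$, $H_3$, $H_4$ or $I_2(m)$ (the dihedral type of rank $2$). Then for all proper subsets $J_1,J_2$ of $I$, $J_1\star_I J_2=\emptyset$.
   Context: $(W,I)$ is a finite Coxeter group with simple reflections $s_i$ ($i\in I$). The monoid operation $\ast$ on $W$ is determined by $T'_xT'_y=T'_{x\ast y}$ in the $0$-Hecke algebra, where $T'_{s_i}$ satisfy $T'^2_{s_i}=T'_{s_i}$ and the braid relations, and $T'_w=T'_{s_{i_1}}\cdots T'_{s_{i_k}}$ for any reduced expression $w=s_{i_1}\cdots s_{i_k}$; equivalently $s_i\ast w$ is the Bruhat-larger of $w$ and $s_iw$. For $J\subset I$, $w_0^J$ is the longest element of $W_J=\langle s_j: j\in J\rangle$. For $J_1,J_2\subset I$, $J_1\star_I J_2$ is the unique subset $K\subset I$ with $(w_0^{J_1}w_0^I)\ast(w_0^{J_2}w_0^I)=w_0^{K}w_0^I$ (such a $K$ always exists). Since $W$ is irreducible, type $I_2(m)$ has $m\ge 3$. *)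

theory Defs
  imports "HOL-Algebra.QuotRing" "HOL-Algebra.Generated_Groups" "HOL-Library.Poly_Mapping"
begin

section \<open>Coxeter systems\<close>

text \<open>The value \<open>0\<close> of a Coxeter matrix encodes \<open>\<infinity>\<close>, that is, no relation.\<close>

definition coxeter_matrix :: "'i set \<Rightarrow> ('i \<Rightarrow> 'i \<Rightarrow> nat) \<Rightarrow> bool" where
  "coxeter_matrix I m \<longleftrightarrow>
     (\<forall>i\<in>I. \<forall>j\<in>I. m i j = m j i \<and> (m i j = 1 \<longleftrightarrow> i = j))"

text \<open>The congruence on words over \<open>I\<close> generated by the relations \<open>(ij)\<^sup>m \<sim> []\<close>, \<open>m = m(i,j)\<close>.
  As \<open>m(i,i) = 1\<close> makes every letter its own inverse, words without inverses suffice, and the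
  quotient of the free monoid is the group presented by these relations.\<close>

inductive coxeter_eq :: "'i set \<Rightarrow> ('i \<Rightarrow> 'i \<Rightarrow> nat) \<Rightarrow> 'i list \<Rightarrow> 'i list \<Rightarrow> bool"
  for I m where
  rel: "i \<in> I \<Longrightarrow> j \<in> I \<Longrightarrow> coxeter_eq I m (concat (replicate (m i j) [i, j])) []"
| refl: "u \<in> lists I \<Longrightarrow> coxeter_eq I m u u"
| sym: "coxeter_eq I m u v \<Longrightarrow> coxeter_eq I m v u"
| trans: "coxeter_eq I m u v \<Longrightarrow> coxeter_eq I m v w \<Longrightarrow> coxeter_eq I m u w"
| append: "coxeter_eq I m u u' \<Longrightarrow> coxeter_eq I m v v' \<Longrightarrow> coxeter_eq I m (u @ v) (u' @ v')"

definition word_val :: "('a, 'b) monoid_scheme \<Rightarrow> ('i \<Rightarrow> 'a) \<Rightarrow> 'i list \<Rightarrow> 'a" where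
  "word_val G s u = foldr (\<lambda>i x. s i \<otimes>\<^bsub>G\<^esub> x) u \<one>\<^bsub>G\<^esub>"

locale coxeter_system = group G for G (structure) +
  fixes I :: "'i set" and s :: "'i \<Rightarrow> 'a" and m :: "'i \<Rightarrow> 'i \<Rightarrow> nat"
  assumes finite_index: "finite I"
    and matrix: "coxeter_matrix I m"
    and simple_closed: "i \<in> I \<Longrightarrow> s i \<in> carrier G"
    and generated: "generate G (s ` I) = carrier G"
    and presented: "u \<in> lists I \<Longrightarrow> v \<in> lists I \<Longrightarrow>
                      word_val G s u = word_val G s v \<longleftrightarrow> coxeter_eq I m u v"

definition irreducible_matrix :: "'i set \<Rightarrow> ('i \<Rightarrow> 'i \<Rightarrow> nat) \<Rightarrow> bool" where
  "irreducible_matrix I m \<longleftrightarrow>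
     I \<noteq> {} \<and> \<not> (\<exists>A. A \<noteq> {} \<and> A \<subset> I \<and> (\<forall>i\<in>A. \<forall>j\<in>I - A. m i j = 2))"

text \<open>The Coxeter diagram is a path whose successive edges carry the labels \<open>ls\<close>.\<close>

definition path_diagram :: "nat list \<Rightarrow> 'i set \<Rightarrow> ('i \<Rightarrow> 'i \<Rightarrow> nat) \<Rightarrow> bool" where
  "path_diagram ls I m \<longleftrightarrow>
     (\<exists>xs. distinct xs \<and> set xs = I \<and> length xs = Suc (length ls) \<and>
        (\<forall>k < length ls. m (xs ! k) (xs ! Suc k) = ls ! k) \<and>
        (\<forall>k l. Suc k < l \<and> l < length xs \<longrightarrow> m (xs ! k) (xs ! l) = 2))"

definition type_F4 :: "'i set \<Rightarrow> ('i \<Rightarrow> 'i \<Rightarrow> nat) \<Rightarrow> bool" where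
  "type_F4 = path_diagram [3, 4, 3]"

definition type_H3 :: "'i set \<Rightarrow> ('i \<Rightarrow> 'i \<Rightarrow> nat) \<Rightarrow> bool" where
  "type_H3 = path_diagram [5, 3]"

definition type_H4 :: "'i set \<Rightarrow> ('i \<Rightarrow> 'i \<Rightarrow> nat) \<Rightarrow> bool" where
  "type_H4 = path_diagram [5, 3, 3]"

definition type_I2 :: "nat \<Rightarrow> 'i set \<Rightarrow> ('i \<Rightarrow> 'i \<Rightarrow> nat) \<Rightarrow> bool" where
  "type_I2 k = path_diagram [k]"


section \<open>The 0-Hecke algebra\<close>

text \<open>The free associative unital \<open>\<int>\<close>-algebra on \<open>I\<close>: finitely supported integer combinations
  of words over \<open>I\<close>, multiplied by bilinear extension of concatenation.\<close>

definition free_algebra :: "'i set \<Rightarrow> ('i list \<Rightarrow>\<^sub>0 int) ring" where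
  "free_algebra I =
     \<lparr>carrier = {f. Poly_Mapping.keys f \<subseteq> lists I},
      monoid.mult = (\<lambda>f g. frag_extend (\<lambda>u. frag_extend (\<lambda>v. frag_of (u @ v)) g) f),
      monoid.one = frag_of [],
      ring.zero = 0,
      ring.add = (+)\<rparr>"

fun alternating :: "'i \<Rightarrow> 'i \<Rightarrow> nat \<Rightarrow> 'i list" where
  "alternating i j 0 = []"
| "alternating i j (Suc n) = i # alternating j i n"

definition hecke_relators :: "'i set \<Rightarrow> ('i \<Rightarrow> 'i \<Rightarrow> nat) \<Rightarrow> ('i list \<Rightarrow>\<^sub>0 int) set" where
  "hecke_relators I m =
     {frag_of [i, i] - frag_of [i] | i. i \<in> I} \<union>
     {frag_of (alternating i j (m i j)) - frag_of (alternating j i (m i j)) | i j.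
        i \<in> I \<and> j \<in> I \<and> i \<noteq> j}"

definition hecke_ideal :: "'i set \<Rightarrow> ('i \<Rightarrow> 'i \<Rightarrow> nat) \<Rightarrow> ('i list \<Rightarrow>\<^sub>0 int) set" where
  "hecke_ideal I m = Idl\<^bsub>free_algebra I\<^esub> (hecke_relators I m)"

definition hecke_algebra :: "'i set \<Rightarrow> ('i \<Rightarrow> 'i \<Rightarrow> nat) \<Rightarrow> ('i list \<Rightarrow>\<^sub>0 int) set ring" where
  "hecke_algebra I m = free_algebra I Quot hecke_ideal I m"

definition hecke_gen :: "'i set \<Rightarrow> ('i \<Rightarrow> 'i \<Rightarrow> nat) \<Rightarrow> 'i \<Rightarrow> ('i list \<Rightarrow>\<^sub>0 int) set" where
  "hecke_gen I m i = hecke_ideal I m +>\<^bsub>free_algebra I\<^esub> frag_of [i]"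


context coxeter_system
begin

definition len :: "'a \<Rightarrow> nat" where
  "len w = (LEAST n. \<exists>u \<in> lists I. length u = n \<and> word_val G s u = w)"

definition reduced_word :: "'i list \<Rightarrow> 'a \<Rightarrow> bool" where
  "reduced_word u w \<longleftrightarrow> u \<in> lists I \<and> word_val G s u = w \<and> length u = len w"

definition longest :: "'i set \<Rightarrow> 'a" where
  "longest J = (THE w. w \<in> generate G (s ` J) \<and> (\<forall>v \<in> generate G (s ` J). len v \<le> len w))"

text \<open>The choice of a reduced word is immaterial, by Matsumoto's theorem and the braid relations.\<close>

definition hecke_basis :: "'a \<Rightarrow> ('i list \<Rightarrow>\<^sub>0 int) set" where
  "hecke_basis w = word_val (hecke_algebra I m) (hecke_gen I m) (SOME u. reduced_word u w)"

definition demazure :: "'a \<Rightarrow> 'a \<Rightarrow> 'a" where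
  "demazure x y = (THE z. z \<in> carrier G \<and>
     hecke_basis x \<otimes>\<^bsub>hecke_algebra I m\<^esub> hecke_basis y = hecke_basis z)"

definition star :: "'i set \<Rightarrow> 'i set \<Rightarrow> 'i set" where
  "star J\<^sub>1 J\<^sub>2 = (THE K. K \<subseteq> I \<and>
     demazure (longest J\<^sub>1 \<otimes> longest I) (longest J\<^sub>2 \<otimes> longest I) = longest K \<otimes> longest I)"

end

end

theory Submission
  imports Defs Complex_Main "HOL-Library.Sublist"
begin

text \<open>Write \<open>w\<^sub>0\<close> for the longest element, \<open>J, K\<close> for the two given proper subsets and \<open>w\<^sub>J, w\<^sub>K\<close> for the
  longest elements of their parabolic subgroups.  The claim is \<open>(w\<^sub>J w\<^sub>0) * (w\<^sub>K w\<^sub>0) = w\<^sub>0\<close>.  Since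
  \<open>w\<^sub>K (w\<^sub>K w\<^sub>0) = w\<^sub>0\<close>, this holds as soon as \<open>w\<^sub>K\<close> lies below \<open>w\<^sub>J w\<^sub>0\<close> in the Bruhat order.  Now
  \<open>w\<^sub>J w\<^sub>0\<close> is the longest of the minimal representatives of the cosets \<open>W\<^sub>J b\<close>, and every such \<open>b\<close> is a
  left factor of it with lengths adding.  So it is enough to exhibit one minimal representative \<open>b\<close>, given
  by a reduced word, with a reduced word of an element that has all of \<open>K\<close> as right descents among its
  subwords (\<open>star_eq_empty\<close>).  Both conditions weaken as \<open>J\<close> and \<open>K\<close> shrink, so \<open>J\<close> and \<open>K\<close> may be taken
  maximal.

  For \<open>F\<^sub>4\<close>, \<open>H\<^sub>3\<close> and \<open>H\<^sub>4\<close> one word of at most \<open>18\<close> letters for each maximal \<open>J\<close> serves all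
  \<open>K\<close>; that it does is checked by computing with root coordinates in \<open>\<int>[\<theta>]\<close>, where \<open>\<theta>\<close> is \<open>sqrt 2\<close> or the
  golden ratio (\<open>star_eq_empty_certificate\<close>).  For \<open>I\<^sub>2(k)\<close> a word of two letters does it.

  Three general facts about Coxeter systems support this.  Lengths are read off from signs of roots in the
  geometric representation (\<open>root_nonneg\<close>), whence lengths add or subtract under multiplication by a
  parabolic subgroup (\<open>len_parabolic_mult\<close>).  Matsumoto's theorem makes the basis of the 0-Hecke algebra
  independent of the choice of reduced words (\<open>hecke_word_reduced\<close>).  Finally, the set of values of all subwords
  of a word is multiplicative and respects the relations of the 0-Hecke algebra, so it is an invariant of
  basis elements (\<open>subword_vals_hecke_word\<close>); it separates them and detects products equal to \<open>w\<^sub>0\<close>.\<close>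


section \<open>The free algebra and its quotients\<close>

lemma free_algebra_simps:
  "carrier (free_algebra I) = {f. Poly_Mapping.keys f \<subseteq> lists I}"
  "f \<otimes>\<^bsub>free_algebra I\<^esub> g = frag_extend (\<lambda>u. frag_extend (\<lambda>v. frag_of (u @ v)) g) f"
  "\<one>\<^bsub>free_algebra I\<^esub> = frag_of []"
  "\<zero>\<^bsub>free_algebra I\<^esub> = 0"
  "f \<oplus>\<^bsub>free_algebra I\<^esub> g = f + g"
  by (simp_all add: free_algebra_def)

lemma frag_extend_fun_diff:
  "frag_extend (\<lambda>u. f u - g u) c = frag_extend f c - frag_extend g c"
proof -
  have "c \<in> {c. Poly_Mapping.keys c \<subseteq> UNIV}" by simp
  then show ?thesis
    using frag_induction[of c UNIV "\<lambda>c. frag_extend (\<lambda>u. f u - g u) c = frag_extend f c - frag_extend g c"]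
    by (simp add: frag_extend_diff)
qed

lemma frag_extend_fun_0 [simp]: "frag_extend (\<lambda>u. 0) c = 0"
  by (rule frag_extend_eq_0) simp

lemma frag_extend_fun_add:
  "frag_extend (\<lambda>u. f u + g u) c = frag_extend f c + frag_extend g c"
  using frag_extend_fun_diff[of f "\<lambda>u. - g u" c] frag_extend_fun_diff[of "\<lambda>u. 0" g c] by simp

lemma ring_free_algebra: "ring (free_algebra I)"
proof (rule ringI)
  show "abelian_group (free_algebra I)"
  proof (rule abelian_groupI)
    fix x assume x: "x \<in> carrier (free_algebra I)"
    then have "- x \<in> carrier (free_algebra I)" by (simp add: free_algebra_simps)
    moreover have "- x \<oplus>\<^bsub>free_algebra I\<^esub> x = \<zero>\<^bsub>free_algebra I\<^esub>"
      by (simp add: free_algebra_simps)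
    ultimately show "\<exists>y\<in>carrier (free_algebra I). y \<oplus>\<^bsub>free_algebra I\<^esub> x = \<zero>\<^bsub>free_algebra I\<^esub>"
      by blast
  next
    fix x y assume "x \<in> carrier (free_algebra I)" "y \<in> carrier (free_algebra I)"
    then show "x \<oplus>\<^bsub>free_algebra I\<^esub> y \<in> carrier (free_algebra I)"
      using Poly_Mapping.keys_add[of x y] by (auto simp: free_algebra_simps)
  qed (auto simp: free_algebra_simps algebra_simps)
  show "Group.monoid (free_algebra I)"
  proof (rule monoidI)
    fix x y assume xy: "x \<in> carrier (free_algebra I)" "y \<in> carrier (free_algebra I)"
    have "Poly_Mapping.keys (frag_extend (\<lambda>u. frag_extend (\<lambda>v. frag_of (u @ v)) y) x) \<subseteq> lists I"
    proof (rule order_trans[OF keys_frag_extend], rule UN_least)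
      fix u assume "u \<in> Poly_Mapping.keys x"
      then show "Poly_Mapping.keys (frag_extend (\<lambda>v. frag_of (u @ v)) y) \<subseteq> lists I"
        using xy by (intro order_trans[OF keys_frag_extend])
          (auto simp: free_algebra_simps dest!: subsetD)
    qed
    then show "x \<otimes>\<^bsub>free_algebra I\<^esub> y \<in> carrier (free_algebra I)"
      by (simp add: free_algebra_simps)
  next
    fix x y z assume x: "x \<in> carrier (free_algebra I)" and y: "y \<in> carrier (free_algebra I)"
      and z: "z \<in> carrier (free_algebra I)"
    have 1: "frag_extend (\<lambda>u. frag_extend (\<lambda>v. frag_of (u @ v)) z)
             (frag_extend (\<lambda>v. frag_of (a @ v)) y)
           = frag_extend (\<lambda>v. frag_of (a @ v)) (frag_extend (\<lambda>u. frag_extend (\<lambda>v. frag_of (u @ v)) z) y)" for a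
    proof -
      have 2: "frag_extend (\<lambda>v. frag_of (a @ v)) (frag_extend (\<lambda>v. frag_of (b @ v)) z) = 
             frag_extend (\<lambda>v. frag_of ((a @ b) @ v)) z" for b
        using frag_extend_compose[of "\<lambda>v. frag_of (a @ v)" "\<lambda>v. b @ v" z] by (simp add: o_def)
      show ?thesis
        using y unfolding free_algebra_simps mem_Collect_eq
        by (induction y rule: frag_induction) (simp_all add: frag_extend_diff 2)
    qed
    show "x \<otimes>\<^bsub>free_algebra I\<^esub> y \<otimes>\<^bsub>free_algebra I\<^esub> z = x \<otimes>\<^bsub>free_algebra I\<^esub> (y \<otimes>\<^bsub>free_algebra I\<^esub> z)"
      using x unfolding free_algebra_simps mem_Collect_eq
      by (induction x rule: frag_induction) (simp_all add: frag_extend_diff 1)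
  next
    fix x assume "x \<in> carrier (free_algebra I)"
    show "\<one>\<^bsub>free_algebra I\<^esub> \<otimes>\<^bsub>free_algebra I\<^esub> x = x"
      by (simp add: free_algebra_simps flip: frag_expansion)
    show "x \<otimes>\<^bsub>free_algebra I\<^esub> \<one>\<^bsub>free_algebra I\<^esub> = x"
      by (simp add: free_algebra_simps flip: frag_expansion)
  qed (simp add: free_algebra_simps)
qed (simp_all add: free_algebra_simps frag_extend_add frag_extend_fun_add)

lemma a_minus_free_algebra:
  assumes "g \<in> carrier (free_algebra I)"
  shows "f \<ominus>\<^bsub>free_algebra I\<^esub> g = f - g"
proof -
  interpret ring "free_algebra I" by (rule ring_free_algebra)
  have "- g \<oplus>\<^bsub>free_algebra I\<^esub> g = \<zero>\<^bsub>free_algebra I\<^esub>" "- g \<in> carrier (free_algebra I)"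
    using assms by (simp_all add: free_algebra_simps)
  then have "\<ominus>\<^bsub>free_algebra I\<^esub> g = - g"
    using assms by (simp add: minus_equality)
  then show ?thesis by (simp add: a_minus_def free_algebra_simps)
qed

lemma frag_of_carrier: "u \<in> lists I \<Longrightarrow> frag_of u \<in> carrier (free_algebra I)"
  by (simp add: free_algebra_simps)

lemma alternating_lists: "i \<in> I \<Longrightarrow> j \<in> I \<Longrightarrow> alternating i j n \<in> lists I"
  by (induction n arbitrary: i j) auto

lemma hecke_relators_carrier: "hecke_relators I m \<subseteq> carrier (free_algebra I)"
proof
  fix r assume "r \<in> hecke_relators I m"
  then consider i where "r = frag_of [i, i] - frag_of [i]" "i \<in> I"
    | i j where "r = frag_of (alternating i j (m i j)) - frag_of (alternating j i (m i j))" "i \<in> I" "j \<in> I"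
    unfolding hecke_relators_def by blast
  then obtain u v where "r = frag_of u - frag_of v" "u \<in> lists I" "v \<in> lists I"
  proof cases
    case 1
    then show ?thesis by (intro that[of "[i, i]" "[i]"]) auto
  next
    case 2
    then show ?thesis by (intro that[OF _ alternating_lists alternating_lists])
  qed
  then show "r \<in> carrier (free_algebra I)"
    using keys_diff[of "frag_of u" "frag_of v"] by (auto simp: free_algebra_simps)
qed

lemma ideal_hecke: "ideal (hecke_ideal I m) (free_algebra I)"
  unfolding hecke_ideal_def
  by (rule ring.genideal_ideal[OF ring_free_algebra hecke_relators_carrier])

lemma word_val_Nil [simp]: "word_val G s [] = \<one>\<^bsub>G\<^esub>"
  by (simp add: word_val_def)

lemma word_val_Cons [simp]: "word_val G s (i # u) = s i \<otimes>\<^bsub>G\<^esub> word_val G s u"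
  by (simp add: word_val_def)

abbreviation hecke_word :: "'i set \<Rightarrow> ('i \<Rightarrow> 'i \<Rightarrow> nat) \<Rightarrow> 'i list \<Rightarrow> ('i list \<Rightarrow>\<^sub>0 int) set" where
  "hecke_word I m u \<equiv> word_val (hecke_algebra I m) (hecke_gen I m) u"

lemma hecke_algebra_simps:
  "x \<otimes>\<^bsub>hecke_algebra I m\<^esub> y = rcoset_mult (free_algebra I) (hecke_ideal I m) x y"
  "\<one>\<^bsub>hecke_algebra I m\<^esub> = hecke_ideal I m +>\<^bsub>free_algebra I\<^esub> frag_of []"
  by (simp_all add: hecke_algebra_def FactRing_def free_algebra_simps)

lemma hecke_word_coset:
  assumes "u \<in> lists I"
  shows "hecke_word I m u = hecke_ideal I m +>\<^bsub>free_algebra I\<^esub> frag_of u"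
  using assms
proof (induction u)
  case Nil
  then show ?case by (simp add: hecke_algebra_simps)
next
  case (Cons i u)
  interpret ideal "hecke_ideal I m" "free_algebra I" by (rule ideal_hecke)
  have "hecke_word I m (i # u) = hecke_ideal I m +>\<^bsub>free_algebra I\<^esub> frag_of [i] \<otimes>\<^bsub>free_algebra I\<^esub> frag_of u"
    using Cons
    by (simp add: hecke_algebra_simps hecke_gen_def[of I m i] rcoset_mult_add frag_of_carrier)
  then show ?case by (simp add: free_algebra_simps)
qed

lemma hecke_word_append:
  assumes "u \<in> lists I" "v \<in> lists I"
  shows "hecke_word I m (u @ v) = hecke_word I m u \<otimes>\<^bsub>hecke_algebra I m\<^esub> hecke_word I m v"
proof -
  interpret ideal "hecke_ideal I m" "free_algebra I" by (rule ideal_hecke)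
  have "hecke_word I m u \<otimes>\<^bsub>hecke_algebra I m\<^esub> hecke_word I m v
     = hecke_ideal I m +>\<^bsub>free_algebra I\<^esub> frag_of u \<otimes>\<^bsub>free_algebra I\<^esub> frag_of v"
    using assms
    by (simp add: hecke_word_coset hecke_algebra_simps rcoset_mult_add frag_of_carrier)
  then show ?thesis using assms by (simp add: free_algebra_simps hecke_word_coset)
qed

lemma hecke_word_eq_iff:
  assumes "u \<in> lists I" "v \<in> lists I"
  shows "hecke_word I m u = hecke_word I m v \<longleftrightarrow> frag_of u - frag_of v \<in> hecke_ideal I m"
proof -
  interpret R: ring "free_algebra I" by (rule ring_free_algebra)
  show ?thesis
    using assms R.quotient_eq_iff_same_a_r_cos[OF ideal_hecke, of "frag_of u" "frag_of v" m]
    by (simp add: hecke_word_coset a_minus_free_algebra frag_of_carrier)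
qed

lemma hecke_ideal_relator: "r \<in> hecke_relators I m \<Longrightarrow> r \<in> hecke_ideal I m"
  unfolding hecke_ideal_def
  using ring.genideal_self[OF ring_free_algebra hecke_relators_carrier] by blast

lemma hecke_word_idem: "i \<in> I \<Longrightarrow> hecke_word I m [i, i] = hecke_word I m [i]"
  by (subst hecke_word_eq_iff) (auto intro!: hecke_ideal_relator simp: hecke_relators_def)

lemma hecke_word_braid:
  "i \<in> I \<Longrightarrow> j \<in> I \<Longrightarrow> i \<noteq> j \<Longrightarrow>
     hecke_word I m (alternating i j (m i j)) = hecke_word I m (alternating j i (m i j))"
  by (subst hecke_word_eq_iff[OF alternating_lists alternating_lists])
    (auto intro!: hecke_ideal_relator simp: hecke_relators_def)

lemma hecke_word_cong:
  assumes "hecke_word I m u = hecke_word I m u'" "hecke_word I m v = hecke_word I m v'"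
    "u \<in> lists I" "v \<in> lists I" "u' \<in> lists I" "v' \<in> lists I"
  shows "hecke_word I m (u @ v) = hecke_word I m (u' @ v')"
  using assms by (simp add: hecke_word_append)

text \<open>An invariant of words separates elements of the quotient algebra as soon as it is
  multiplicative and satisfies the relations of the algebra: its linear extension to
  combinations of words then kills the ideal.\<close>

lemma hecke_word_invariant:
  fixes S :: "'i list \<Rightarrow> 'b"
  assumes hom: "\<And>u v. u \<in> lists I \<Longrightarrow> v \<in> lists I \<Longrightarrow> S (u @ v) = M (S u) (S v)"
    and idem: "\<And>i. i \<in> I \<Longrightarrow> S [i, i] = S [i]"
    and braid: "\<And>i j. i \<in> I \<Longrightarrow> j \<in> I \<Longrightarrow> i \<noteq> j \<Longrightarrow>
      S (alternating i j (m i j)) = S (alternating j i (m i j))"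
    and "u \<in> lists I" "v \<in> lists I" "hecke_word I m u = hecke_word I m v"
  shows "S u = S v"
proof -
  interpret R: ring "free_algebra I" by (rule ring_free_algebra)
  let ?F = "frag_extend (\<lambda>u. frag_of (S u))"
  define K where "K = {f \<in> carrier (free_algebra I). ?F f = 0}"
  have F_mult: "?F (f \<otimes>\<^bsub>free_algebra I\<^esub> g) =
      frag_extend (\<lambda>a. frag_extend (\<lambda>b. frag_of (M a b)) (?F g)) (?F f)"
    if f: "f \<in> carrier (free_algebra I)" and g: "g \<in> carrier (free_algebra I)" for f g
  proof -
    have 1: "?F (frag_extend (\<lambda>v. frag_of (u @ v)) g)
        = frag_extend (\<lambda>b. frag_of (M (S u) b)) (?F g)" if "u \<in> lists I" for u
      using g unfolding free_algebra_simps mem_Collect_eq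
      by (induction g rule: frag_induction) (simp_all add: frag_extend_diff hom that)
    show ?thesis
      using f unfolding free_algebra_simps mem_Collect_eq
      by (induction f rule: frag_induction) (simp_all add: frag_extend_diff 1)
  qed
  have K: "ideal K (free_algebra I)"
  proof (rule idealI[OF ring_free_algebra])
    show "subgroup K (add_monoid (free_algebra I))"
    proof (rule R.add.subgroupI)
      show "K \<subseteq> carrier (free_algebra I)" "K \<noteq> {}"
        by (auto simp: K_def free_algebra_simps intro!: exI[of _ 0])
    next
      fix a assume a: "a \<in> K"
      have 1: "\<zero>\<^bsub>free_algebra I\<^esub> \<ominus>\<^bsub>free_algebra I\<^esub> a = - a"
        using a by (subst a_minus_free_algebra) (auto simp: K_def free_algebra_simps)
      have "\<ominus>\<^bsub>free_algebra I\<^esub> a = - a"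
        using a 1 by (simp add: a_minus_def K_def)
      then show "\<ominus>\<^bsub>free_algebra I\<^esub> a \<in> K"
        using a by (simp add: K_def free_algebra_simps frag_extend_minus)
    next
      fix a b assume "a \<in> K" "b \<in> K"
      then show "a \<oplus>\<^bsub>free_algebra I\<^esub> b \<in> K"
        using R.add.m_closed[of a b]
        by (auto simp: K_def free_algebra_simps frag_extend_add)
    qed
  next
    fix a x assume "a \<in> K" "x \<in> carrier (free_algebra I)"
    then show "x \<otimes>\<^bsub>free_algebra I\<^esub> a \<in> K" "a \<otimes>\<^bsub>free_algebra I\<^esub> x \<in> K"
      by (simp_all add: K_def F_mult)
  qed
  have "hecke_relators I m \<subseteq> K"
  proof
    fix r assume r: "r \<in> hecke_relators I m"
    then consider i where "r = frag_of [i, i] - frag_of [i]" "i \<in> I"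
      | i j where "r = frag_of (alternating i j (m i j)) - frag_of (alternating j i (m i j))"
          "i \<in> I" "j \<in> I" "i \<noteq> j"
      unfolding hecke_relators_def by blast
    then have "?F r = 0"
    proof cases
      case 1
      then show ?thesis by (simp add: frag_extend_diff idem)
    next
      case (2 i j)
      show ?thesis
        unfolding 2(1) frag_extend_diff frag_extend_of braid[OF 2(2-4)] by simp
    qed
    then show "r \<in> K" using r hecke_relators_carrier[of I m] by (auto simp: K_def)
  qed
  then have "hecke_ideal I m \<subseteq> K"
    unfolding hecke_ideal_def by (rule R.genideal_minimal[OF K])
  then have "frag_of u - frag_of v \<in> K"
    using hecke_word_eq_iff[OF assms(4,5)] assms(6) by blast
  then show ?thesis
    unfolding K_def frag_extend_diff frag_extend_of mem_Collect_eq right_minus_eq frag_of_eq by blast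
qed


section \<open>Words and the length function\<close>

text \<open>Membership in \<open>lists\<close> stays folded, as it is the form in which words are constrained.\<close>

declare in_listsD [rule del] in_listsI [rule del]

lemma lists_subset: "u \<in> lists J \<Longrightarrow> J \<subseteq> I \<Longrightarrow> u \<in> lists I"
  using lists_mono by blast

lemma rev_in_lists [simp]: "rev u \<in> lists I \<longleftrightarrow> u \<in> lists I"
  by (induction u) auto

lemma alternating_snoc: "alternating i j (Suc n) = alternating i j n @ [if even n then i else j]"
  by (induction n arbitrary: i j) auto

lemma length_alternating [simp]: "length (alternating i j n) = n"
  by (induction n arbitrary: i j) auto

lemma concat_replicate_in_lists: "u \<in> lists I \<Longrightarrow> concat (replicate n u) \<in> lists I"
  by (induction n) auto

lemma coxeter_eq_lists: "coxeter_eq I m u v \<Longrightarrow> u \<in> lists I \<and> v \<in> lists I"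
  by (induction rule: coxeter_eq.induct) (auto simp: concat_replicate_in_lists)

lemma length_concat_replicate: "length (concat (replicate n xs)) = n * length xs"
  by (induction n) auto

lemma coxeter_eq_parity: "coxeter_eq I m u v \<Longrightarrow> even (length u) = even (length v)"
  by (induction rule: coxeter_eq.induct) (auto simp: length_concat_replicate)

context coxeter_system
begin

abbreviation val :: "'i list \<Rightarrow> 'a" where "val u \<equiv> word_val G s u"

lemma val_closed [simp, intro]: "u \<in> lists I \<Longrightarrow> val u \<in> carrier G"
  by (induction u) (auto simp: simple_closed)

lemma val_append: "u \<in> lists I \<Longrightarrow> v \<in> lists I \<Longrightarrow> val (u @ v) = val u \<otimes> val v"
  by (induction u) (auto simp: simple_closed m_assoc)

lemma val_eqI: "coxeter_eq I m u v \<Longrightarrow> val u = val v"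
  using coxeter_eq_lists[of I m u v] presented[of u v] by simp

lemma simple_sq [simp]: "i \<in> I \<Longrightarrow> s i \<otimes> s i = \<one>"
proof -
  assume i: "i \<in> I"
  then have "m i i = 1" using matrix by (auto simp: coxeter_matrix_def)
  then have "coxeter_eq I m [i, i] []" using coxeter_eq.rel[OF i i, of m] by simp
  then have "val [i, i] = val []" by (rule val_eqI)
  then show ?thesis using i by (simp add: simple_closed)
qed

lemma simple_cancel [simp]: "i \<in> I \<Longrightarrow> g \<in> carrier G \<Longrightarrow> s i \<otimes> (s i \<otimes> g) = g"
  by (simp add: simple_closed flip: m_assoc)

lemma simple_cancel_right [simp]: "i \<in> I \<Longrightarrow> g \<in> carrier G \<Longrightarrow> g \<otimes> s i \<otimes> s i = g"
  by (simp add: simple_closed m_assoc)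

lemma inv_simple: "i \<in> I \<Longrightarrow> inv (s i) = s i"
  by (simp add: inv_equality simple_closed)

lemma val_rev: "u \<in> lists I \<Longrightarrow> val (rev u) = inv (val u)"
  by (induction u) (simp_all add: simple_closed val_append inv_mult_group inv_simple)

lemma generate_simple_iff:
  assumes "J \<subseteq> I"
  shows "g \<in> generate G (s ` J) \<longleftrightarrow> (\<exists>u\<in>lists J. val u = g)"
proof
  assume "g \<in> generate G (s ` J)"
  then show "\<exists>u\<in>lists J. val u = g"
  proof (induction rule: generate.induct)
    case one
    then show ?case by (intro bexI[of _ "[]"]) auto
  next
    case (incl h)
    then obtain j where "j \<in> J" "h = s j" by blast
    then show ?case using assms by (intro bexI[of _ "[j]"]) (auto simp: simple_closed)
  next
    case (inv h)
    then obtain j where "j \<in> J" "h = s j" by blast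
    then show ?case using assms
      by (intro bexI[of _ "[j]"]) (auto simp: simple_closed inv_simple subset_iff)
  next
    case (eng g h)
    then obtain u v where "u \<in> lists J" "v \<in> lists J" "val u = g" "val v = h" by blast
    then show ?case using assms
      by (intro bexI[of _ "u @ v"]) (auto simp: val_append lists_subset)
  qed
next
  assume "\<exists>u\<in>lists J. val u = g"
  then obtain u where "u \<in> lists J" "val u = g" by blast
  moreover have "val u \<in> generate G (s ` J)" if "u \<in> lists J" for u
    using that by (induction u) (auto intro: generate.intros)
  ultimately show "g \<in> generate G (s ` J)" by blast
qed

lemma carrier_iff: "g \<in> carrier G \<longleftrightarrow> (\<exists>u\<in>lists I. val u = g)"
  using generate_simple_iff[of I g] generated by simp

lemma generate_carrier: "J \<subseteq> I \<Longrightarrow> g \<in> generate G (s ` J) \<Longrightarrow> g \<in> carrier G"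
  using generate_simple_iff lists_mono carrier_iff by blast

lemma ex_reduced_word: "g \<in> carrier G \<Longrightarrow> \<exists>u. reduced_word u g"
proof -
  assume "g \<in> carrier G"
  then obtain u where "u \<in> lists I" "val u = g" using carrier_iff by blast
  then have "\<exists>n. \<exists>u\<in>lists I. length u = n \<and> val u = g" by blast
  then have "\<exists>u\<in>lists I. length u = len g \<and> val u = g"
    unfolding len_def by (rule LeastI_ex)
  then show ?thesis by (auto simp: reduced_word_def)
qed

lemma len_val_le: "u \<in> lists I \<Longrightarrow> len (val u) \<le> length u"
  unfolding len_def by (rule Least_le) blast

lemma len_one [simp]: "len \<one> = 0"
  using len_val_le[of "[]"] by simp

lemma len_eq_0: "g \<in> carrier G \<Longrightarrow> len g = 0 \<Longrightarrow> g = \<one>"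
  using ex_reduced_word[of g] by (auto simp: reduced_word_def)

lemma len_mult_le: "g \<in> carrier G \<Longrightarrow> h \<in> carrier G \<Longrightarrow> len (g \<otimes> h) \<le> len g + len h"
  using ex_reduced_word[of g] ex_reduced_word[of h] len_val_le val_append
  by (metis append_in_lists_conv length_append reduced_word_def)

lemma len_inv [simp]: "g \<in> carrier G \<Longrightarrow> len (inv g) = len g"
proof -
  have "len (inv g) \<le> len g" if "g \<in> carrier G" for g
    using ex_reduced_word[OF that] len_val_le[of "rev _"] val_rev
    by (metis in_lists_conv_set length_rev reduced_word_def set_rev)
  from this[of g] this[of "inv g"] show "g \<in> carrier G \<Longrightarrow> ?thesis" by simp
qed

lemma len_val_parity: "u \<in> lists I \<Longrightarrow> even (len (val u)) = even (length u)"
  using ex_reduced_word[of "val u"] presented coxeter_eq_parity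
  by (metis reduced_word_def val_closed)

lemma len_simple_left:
  assumes "i \<in> I" "g \<in> carrier G"
  shows "len (s i \<otimes> g) = Suc (len g) \<or> len g = Suc (len (s i \<otimes> g))"
proof -
  have le: "len (s i \<otimes> g) \<le> Suc (len g)" if "g \<in> carrier G" for g
    using len_mult_le[of "s i" g] len_val_le[of "[i]"] assms that by (auto simp: simple_closed)
  obtain u where "u \<in> lists I" "val u = g" using carrier_iff assms by blast
  then have "even (len (s i \<otimes> g)) \<noteq> even (len g)"
    using len_val_parity[of u] len_val_parity[of "i # u"] assms by auto
  moreover have "len g \<le> Suc (len (s i \<otimes> g))"
    using le[of "s i \<otimes> g"] assms by (simp add: simple_closed)
  moreover note le[OF assms(2)]
  ultimately show ?thesis by (cases "len (s i \<otimes> g) = len g") auto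
qed

lemma len_simple_right:
  assumes "i \<in> I" "g \<in> carrier G"
  shows "len (g \<otimes> s i) = Suc (len g) \<or> len g = Suc (len (g \<otimes> s i))"
  using len_simple_left[OF assms(1), of "inv g"] assms
    len_inv[of "g \<otimes> s i"] by (simp add: simple_closed inv_mult_group inv_simple)

lemma val_alternating_braid:
  assumes "i \<in> I" "j \<in> I"
  shows "val (alternating i j (m i j)) = val (alternating j i (m i j))"
proof -
  have eq: "concat (replicate n [i, j]) = alternating i j (2 * n)" for n
    by (induction n) auto
  have app: "alternating i j n @ rev (alternating j i n) = alternating i j (2 * n)" for i j :: 'i and n
  proof (induction n arbitrary: i j)
    case (Suc n)
    have "alternating i j (Suc n) @ rev (alternating j i (Suc n))
        = i # (alternating j i n @ rev (alternating i j n)) @ [j]" by simp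
    also have "\<dots> = alternating i j (2 * Suc n)"
      unfolding Suc using alternating_snoc[of j i "2 * n"] by simp
    finally show ?case .
  qed simp
  have l: "alternating i j (m i j) \<in> lists I" "alternating j i (m i j) \<in> lists I"
    using assms alternating_lists by metis+
  have "val (alternating i j (m i j) @ rev (alternating j i (m i j))) = val []"
    using val_eqI[OF coxeter_eq.rel[OF assms]] by (simp add: app eq)
  then have "val (alternating i j (m i j)) \<otimes> inv (val (alternating j i (m i j))) = \<one>"
    using l by (simp add: val_append val_rev in_listsI)
  then show ?thesis
    using l by (metis inv_closed inv_equality inv_inv val_closed)
qed

end


section \<open>The geometric representation\<close>

text \<open>A vector is the family of its coordinates with respect to the simple roots.  Coordinates outside the
  index set are carried along unchanged, so that the reflections need no restriction.\<close>

definition cartan :: "('i \<Rightarrow> 'i \<Rightarrow> nat) \<Rightarrow> 'i \<Rightarrow> 'i \<Rightarrow> real" where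
  "cartan m i j = - 2 * cos (pi / m i j)"

definition coroot :: "'i set \<Rightarrow> ('i \<Rightarrow> 'i \<Rightarrow> nat) \<Rightarrow> 'i \<Rightarrow> ('i \<Rightarrow> real) \<Rightarrow> real" where
  "coroot I m i x = (\<Sum>j\<in>I. cartan m i j * x j)"

definition reflect :: "'i set \<Rightarrow> ('i \<Rightarrow> 'i \<Rightarrow> nat) \<Rightarrow> 'i \<Rightarrow> ('i \<Rightarrow> real) \<Rightarrow> 'i \<Rightarrow> real" where
  "reflect I m i x = x(i := x i - coroot I m i x)"

definition act :: "'i set \<Rightarrow> ('i \<Rightarrow> 'i \<Rightarrow> nat) \<Rightarrow> 'i list \<Rightarrow> ('i \<Rightarrow> real) \<Rightarrow> 'i \<Rightarrow> real" where
  "act I m u x = foldr (reflect I m) u x"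

definition simple_root :: "'i \<Rightarrow> 'i \<Rightarrow> real" where
  "simple_root i = (\<lambda>k. if k = i then 1 else 0)"

text \<open>One binary operation, pointwise, so that linearity of the action is a single rewrite rule.\<close>

definition lincomb :: "real \<Rightarrow> ('i \<Rightarrow> real) \<Rightarrow> real \<Rightarrow> ('i \<Rightarrow> real) \<Rightarrow> 'i \<Rightarrow> real" where
  "lincomb a x b y = (\<lambda>k. a * x k + b * y k)"

lemma act_simps [simp]:
  "act I m [] x = x" "act I m (i # u) x = reflect I m i (act I m u x)"
  by (simp_all add: act_def)

lemma act_append: "act I m (u @ v) x = act I m u (act I m v x)"
  by (simp add: act_def)

lemma coroot_lincomb:
  "coroot I m i (lincomb a x b y) = a * coroot I m i x + b * coroot I m i y"
  by (simp add: coroot_def lincomb_def sum.distrib sum_distrib_left algebra_simps)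

lemma reflect_lincomb: "reflect I m i (lincomb a x b y) = lincomb a (reflect I m i x) b (reflect I m i y)"
  by (rule ext) (simp add: reflect_def coroot_lincomb, simp add: lincomb_def algebra_simps)

lemma act_lincomb: "act I m u (lincomb a x b y) = lincomb a (act I m u x) b (act I m u y)"
  by (induction u) (auto simp: reflect_lincomb)

lemma coroot_simple_root: "finite I \<Longrightarrow> j \<in> I \<Longrightarrow> coroot I m i (simple_root j) = cartan m i j"
  by (simp add: coroot_def simple_root_def if_distrib sum.delta' cong: if_cong)

lemma cartan_diag: "m i i = 1 \<Longrightarrow> cartan m i i = 2"
  by (simp add: cartan_def)

context coxeter_system
begin

abbreviation "wact \<equiv> act I m"

lemma label_diag: "i \<in> I \<Longrightarrow> m i i = 1" and label_sym: "i \<in> I \<Longrightarrow> j \<in> I \<Longrightarrow> m i j = m j i"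
  and label_neq_1: "i \<in> I \<Longrightarrow> j \<in> I \<Longrightarrow> i \<noteq> j \<Longrightarrow> m i j \<noteq> 1"
  using matrix by (auto simp: coxeter_matrix_def)

lemma reflect_sq [simp]: "i \<in> I \<Longrightarrow> reflect I m i (reflect I m i x) = x"
proof -
  assume i: "i \<in> I"
  have "reflect I m i x = lincomb 1 x (- coroot I m i x) (simple_root i)"
    by (auto simp: reflect_def lincomb_def simple_root_def)
  then have "coroot I m i (reflect I m i x) = - coroot I m i x"
    using i by (simp add: coroot_lincomb coroot_simple_root finite_index label_diag cartan_diag)
  then show ?thesis by (simp add: reflect_def[of I m i "reflect I m i x"]) (simp add: reflect_def)
qed

text \<open>On the plane spanned by two simple roots with angle \<open>\<theta> = pi / m i j\<close> between the mirrors,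
  the vectors \<open>sin (\<phi> + \<theta>) \<alpha>\<^sub>i + sin \<phi> \<alpha>\<^sub>j\<close> form a circle on which the two reflections act by
  shifting the phase: this follows from \<open>sin (\<phi> + 2 \<theta>) + sin \<phi> = 2 cos \<theta> sin (\<phi> + \<theta>)\<close>.\<close>

lemma reflect_circle:
  assumes "i \<in> I" "j \<in> I" "i \<noteq> j" and \<theta>: "\<theta> = pi / m i j"
  shows "reflect I m j (lincomb (sin (\<phi> + \<theta>)) (simple_root i) (sin \<phi>) (simple_root j))
       = lincomb (sin (\<phi> + \<theta>)) (simple_root i) (sin (\<phi> + 2 * \<theta>)) (simple_root j)"
proof -
  have c: "cartan m j i = - 2 * cos \<theta>" "cartan m j j = 2"
    using assms by (simp_all add: cartan_def label_sym[of j i] label_diag)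
  have "sin (\<phi> + 2 * \<theta>) + sin \<phi> = sin ((\<phi> + \<theta>) + \<theta>) + sin ((\<phi> + \<theta>) - \<theta>)"
    by (simp add: algebra_simps)
  also have "\<dots> = 2 * cos \<theta> * sin (\<phi> + \<theta>)"
    unfolding sin_add[of "\<phi> + \<theta>"] sin_diff[of "\<phi> + \<theta>"] by simp
  finally have 1: "sin (\<phi> + 2 * \<theta>) = 2 * cos \<theta> * sin (\<phi> + \<theta>) - sin \<phi>" by simp
  show ?thesis
    using assms(1-3)
    by (auto simp: reflect_def fun_eq_iff coroot_simple_root finite_index c 1 coroot_lincomb)
      (auto simp: lincomb_def simple_root_def)
qed

lemma lincomb_commute: "lincomb a x b y = lincomb b y a x"
  by (auto simp: lincomb_def)

lemma reflect_circle':
  assumes "i \<in> I" "j \<in> I" "i \<noteq> j" and \<theta>: "\<theta> = pi / m i j"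
  shows "reflect I m i (lincomb (sin \<phi>) (simple_root i) (sin (\<phi> + \<theta>)) (simple_root j))
       = lincomb (sin (\<phi> + 2 * \<theta>)) (simple_root i) (sin (\<phi> + \<theta>)) (simple_root j)"
  using reflect_circle[OF assms(2,1) assms(3)[symmetric], of \<theta> \<phi>] assms label_sym[of i j]
  by (simp add: lincomb_commute)

lemma rotation_circle:
  assumes "i \<in> I" "j \<in> I" "i \<noteq> j" and \<theta>: "\<theta> = pi / m i j"
  shows "wact (concat (replicate n [i, j])) (lincomb (sin (\<phi> + \<theta>)) (simple_root i) (sin \<phi>) (simple_root j))
       = lincomb (sin (\<phi> + 2 * n * \<theta> + \<theta>)) (simple_root i) (sin (\<phi> + 2 * n * \<theta>)) (simple_root j)"
proof (induction n)
  case (Suc n)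
  define X where "X = \<phi> + 2 * n * \<theta>"
  have X: "\<phi> + 2 * real (Suc n) * \<theta> = X + \<theta> + \<theta>" "X + 2 * \<theta> = X + \<theta> + \<theta>"
    "X + \<theta> + \<theta> + \<theta> = X + \<theta> + 2 * \<theta>"
    by (simp_all add: X_def algebra_simps)
  have "wact (concat (replicate (Suc n) [i, j])) (lincomb (sin (\<phi> + \<theta>)) (simple_root i) (sin \<phi>) (simple_root j))
      = reflect I m i (reflect I m j (lincomb (sin (X + \<theta>)) (simple_root i) (sin X) (simple_root j)))"
    by (simp add: Suc X_def)
  also have "\<dots> = lincomb (sin (X + \<theta> + 2 * \<theta>)) (simple_root i) (sin (X + \<theta> + \<theta>)) (simple_root j)"
    unfolding reflect_circle[OF assms] X(2) reflect_circle'[OF assms] ..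
  finally show ?case unfolding X(1,3) .
qed simp

lemma reflect_fix: "coroot I m i x = 0 \<Longrightarrow> reflect I m i x = x"
  by (simp add: reflect_def)

end

locale finite_label_coxeter_system = coxeter_system G I s m
  for G (structure) and I :: "'i set" and s :: "'i \<Rightarrow> 'a" and m +
  assumes label_nonzero: "i \<in> I \<Longrightarrow> j \<in> I \<Longrightarrow> m i j \<noteq> 0"
begin

lemma label_ge_2: "i \<in> I \<Longrightarrow> j \<in> I \<Longrightarrow> i \<noteq> j \<Longrightarrow> m i j \<ge> 2"
  using label_nonzero[of i j] label_neq_1[of i j] by linarith

text \<open>The plane spanned by two simple roots has a complement fixed by both reflections, as the
  form is nondegenerate on the plane; so the product of the reflections has the order of a
  rotation of the plane.\<close>

lemma act_rel:
  assumes "i \<in> I" "j \<in> I"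
  shows "wact (concat (replicate (m i j) [i, j])) x = x"
proof (cases "i = j")
  case True
  then show ?thesis using assms by (simp add: label_diag)
next
  case False
  define \<theta> where "\<theta> = pi / m i j"
  have m: "m i j \<ge> 2" using label_ge_2 assms False by simp
  then have \<theta>: "0 < \<theta>" "\<theta> < pi" by (auto simp: \<theta>_def field_simps)
  then have sin: "sin \<theta> \<noteq> 0" using sin_gt_zero[of \<theta>] by auto
  define A B where "A = coroot I m i x" and "B = coroot I m j x"
  define t where "t = cos \<theta>"
  have t: "sin \<theta> ^ 2 = 1 - t\<^sup>2" using sin_cos_squared_add[of \<theta>] unfolding t_def by linarith
  have c: "cartan m i j = - 2 * t" "cartan m j i = - 2 * t" "cartan m i i = 2" "cartan m j j = 2"
    using assms label_sym[of i j] by (simp_all add: t_def cartan_def \<theta>_def label_diag)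
  define d where "d = 2 * (1 - t\<^sup>2)"
  have d: "d \<noteq> 0" using t sin by (simp add: d_def flip: t)
  define p q where "p = (A + t * B) / d" and "q = (B + t * A) / d"
  have "2 * p - 2 * t * q = (2 * (A + t * B) - 2 * t * (B + t * A)) / d"
    by (simp add: p_def q_def diff_divide_distrib)
  also have "\<dots> = (A * d) / d" by (simp add: d_def algebra_simps power2_eq_square)
  finally have pA: "2 * p - 2 * t * q = A" using d by simp
  have "2 * q - 2 * t * p = (2 * (B + t * A) - 2 * t * (A + t * B)) / d"
    by (simp add: p_def q_def diff_divide_distrib)
  also have "\<dots> = (B * d) / d" by (simp add: d_def algebra_simps power2_eq_square)
  finally have qB: "2 * q - 2 * t * p = B" using d by simp
  define z where "z = lincomb p (simple_root i) q (simple_root j)"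
  define y where "y = lincomb 1 x (- 1) z"
  have "coroot I m i y = 0" "coroot I m j y = 0"
    using assms pA qB
    by (simp_all add: y_def z_def coroot_lincomb coroot_simple_root finite_index c flip: A_def B_def,
        simp_all add: algebra_simps)
  then have fix_y: "wact (concat (replicate n [i, j])) y = y" for n
    by (induction n) (simp_all add: reflect_fix)
  have rot: "wact (concat (replicate (m i j) [i, j])) (lincomb (sin (\<phi> + \<theta>)) (simple_root i) (sin \<phi>) (simple_root j))
       = lincomb (sin (\<phi> + \<theta>)) (simple_root i) (sin \<phi>) (simple_root j)" for \<phi>
  proof -
    have "2 * real (m i j) * \<theta> = 2 * pi" using m by (simp add: \<theta>_def)
    then have "\<phi> + 2 * real (m i j) * \<theta> = \<phi> + 2 * pi"
      "\<phi> + 2 * real (m i j) * \<theta> + \<theta> = \<phi> + \<theta> + 2 * pi" by simp_all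
    then show ?thesis
      using rotation_circle[OF assms False \<theta>_def, of "m i j" \<phi>] by (simp only: sin_periodic)
  qed
  have z: "z = lincomb (p / sin \<theta>) (lincomb (sin (0 + \<theta>)) (simple_root i) (sin 0) (simple_root j))
        (- q / sin \<theta>) (lincomb (sin (- \<theta> + \<theta>)) (simple_root i) (sin (- \<theta>)) (simple_root j))"
    using sin by (simp add: z_def lincomb_def fun_eq_iff)
  have fix_z: "wact (concat (replicate (m i j) [i, j])) z = z"
    unfolding z by (subst act_lincomb) (simp only: rot)
  have x: "x = lincomb 1 y 1 z" by (simp add: y_def lincomb_def fun_eq_iff)
  show ?thesis by (subst (1 2) x) (simp only: act_lincomb fix_y fix_z)
qed

lemma act_coxeter_eq: "coxeter_eq I m u v \<Longrightarrow> wact u x = wact v x"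
  by (induction arbitrary: x rule: coxeter_eq.induct) (auto simp: act_rel act_append)

lemma act_val_cong:
  "u \<in> lists I \<Longrightarrow> v \<in> lists I \<Longrightarrow> val u = val v \<Longrightarrow> wact u x = wact v x"
  using presented act_coxeter_eq by blast

end


section \<open>Lengths and the signs of roots\<close>

context finite_label_coxeter_system
begin

text \<open>The choice of a word is immaterial because the action respects the defining relations.\<close>

definition gact :: "'a \<Rightarrow> ('i \<Rightarrow> real) \<Rightarrow> 'i \<Rightarrow> real" where
  "gact g = wact (SOME u. u \<in> lists I \<and> val u = g)"

lemma gact_val: "u \<in> lists I \<Longrightarrow> gact (val u) x = wact u x"
proof -
  assume u: "u \<in> lists I"
  let ?v = "SOME v. v \<in> lists I \<and> val v = val u"
  have "?v \<in> lists I \<and> val ?v = val u" by (rule someI[of _ u]) (use u in simp)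
  then show ?thesis unfolding gact_def using u act_val_cong[of ?v u] by blast
qed

lemma gact_mult:
  "g \<in> carrier G \<Longrightarrow> h \<in> carrier G \<Longrightarrow> gact (g \<otimes> h) x = gact g (gact h x)"
  unfolding carrier_iff by (auto simp: gact_val act_append simp flip: val_append)

lemma gact_one [simp]: "gact \<one> x = x"
  using gact_val[of "[]"] by simp

lemma gact_simple: "i \<in> I \<Longrightarrow> gact (s i) x = reflect I m i x"
  using gact_val[of "[i]"] by (simp add: simple_closed)

lemma gact_lincomb:
  "g \<in> carrier G \<Longrightarrow> gact g (lincomb a x b y) = lincomb a (gact g x) b (gact g y)"
  unfolding carrier_iff by (auto simp: gact_val act_lincomb)

lemma gact_inv_cancel [simp]: "g \<in> carrier G \<Longrightarrow> gact (inv g) (gact g x) = x"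
  by (simp flip: gact_mult)

lemma gact_zero: "g \<in> carrier G \<Longrightarrow> gact g (\<lambda>k. 0) = (\<lambda>k. 0)"
  using gact_lincomb[of g 0 "\<lambda>k. 0" 0 "\<lambda>k. 0"] by (simp add: lincomb_def)

lemma gact_expand:
  assumes "finite J" "g \<in> carrier G" "\<And>k. k \<notin> J \<Longrightarrow> x k = 0"
  shows "gact g x k = (\<Sum>j\<in>J. x j * gact g (simple_root j) k)"
  using assms(1,3)
proof (induction J arbitrary: x rule: finite_induct)
  case empty
  then have "x = (\<lambda>k. 0)" by auto
  then show ?case using assms(2) by (simp add: gact_zero)
next
  case (insert j J)
  have x: "x = lincomb 1 (x(j := 0)) (x j) (simple_root j)"
    by (auto simp: lincomb_def simple_root_def)
  have "gact g x = lincomb 1 (gact g (x(j := 0))) (x j) (gact g (simple_root j))"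
    by (subst x) (rule gact_lincomb[OF assms(2)])
  moreover have "gact g (x(j := 0)) k = (\<Sum>i\<in>J. (x(j := 0)) i * gact g (simple_root i) k)"
    using insert.prems by (intro insert.IH) auto
  moreover have "\<dots> = (\<Sum>i\<in>J. x i * gact g (simple_root i) k)"
    using insert.hyps by (intro sum.cong) auto
  ultimately show ?case using insert.hyps by (simp add: lincomb_def)
qed

text \<open>Signs multiply because the image of \<open>x\<close> is the combination of the images of the simple roots with the
  coordinates of \<open>x\<close> as coefficients.\<close>

lemma gact_sign:
  fixes \<epsilon> \<delta> :: real
  assumes "finite J" "g \<in> carrier G" "\<And>k. k \<notin> J \<Longrightarrow> x k = 0"
    and "\<And>k. 0 \<le> \<epsilon> * x k" and "\<And>j k. j \<in> J \<Longrightarrow> 0 \<le> \<delta> * gact g (simple_root j) k"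
  shows "0 \<le> \<epsilon> * \<delta> * gact g x k"
proof -
  have "\<epsilon> * \<delta> * gact g x k = (\<Sum>j\<in>J. (\<epsilon> * x j) * (\<delta> * gact g (simple_root j) k))"
    by (simp add: gact_expand[OF assms(1,2), of x k] assms(3)) (simp add: sum_distrib_left mult_ac)
  also have "\<dots> \<ge> 0" by (rule sum_nonneg, rule mult_nonneg_nonneg) (use assms in auto)
  finally show ?thesis .
qed

lemma wact_support:
  assumes "u \<in> lists J" "j \<in> J" "k \<notin> J"
  shows "wact u (simple_root j) k = 0"
  using assms by (induction u) (auto simp: reflect_def simple_root_def)

lemma alternating_circle:
  fixes \<theta> :: real
  assumes "i \<in> I" "t \<in> I" "i \<noteq> t" and \<theta>: "\<theta> = pi / m i t"
  shows "wact (rev (alternating t i n)) (lincomb (sin \<theta>) (simple_root i) 0 (simple_root t)) =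
    (if even n then lincomb (sin (Suc n * \<theta>)) (simple_root i) (sin (n * \<theta>)) (simple_root t)
     else lincomb (sin (n * \<theta>)) (simple_root i) (sin (Suc n * \<theta>)) (simple_root t))"
proof (induction n)
  case (Suc n)
  have eq: "real (Suc n) * \<theta> = n * \<theta> + \<theta>" "real (Suc (Suc n)) * \<theta> = n * \<theta> + 2 * \<theta>"
    by (simp_all add: algebra_simps)
  have "rev (alternating t i (Suc n)) = (if even n then t else i) # rev (alternating t i n)"
    by (simp add: alternating_snoc del: alternating.simps)
  then show ?case
    using Suc reflect_circle[OF assms, of "n * \<theta>"] reflect_circle'[OF assms, of "n * \<theta>"]
    unfolding eq by (simp del: of_nat_Suc alternating.simps)
qed simp

text \<open>The coordinates of the image are \<open>sin (l \<theta>) / sin \<theta>\<close> with \<open>l \<le> m i t\<close>, and \<open>l \<theta> \<le> pi\<close>.\<close>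

lemma alternating_root:
  assumes "i \<in> I" "t \<in> I" "i \<noteq> t" "n < m i t"
  obtains a b where "a \<ge> 0" "b \<ge> 0"
    "wact (rev (alternating t i n)) (simple_root i) = lincomb a (simple_root i) b (simple_root t)"
proof -
  define \<theta> where "\<theta> = pi / m i t"
  have m: "m i t \<ge> 2" using label_ge_2 assms by simp
  then have \<theta>: "0 < \<theta>" "\<theta> < pi" by (auto simp: \<theta>_def field_simps)
  then have sin0: "sin \<theta> > 0" using sin_gt_zero[of \<theta>] by auto
  have sin: "sin (k * \<theta>) \<ge> 0" if "k \<le> m i t" for k :: nat
  proof (rule sin_ge_zero)
    have "real k * \<theta> \<le> m i t * \<theta>" using that \<theta> by (intro mult_right_mono) auto
    then show "real k * \<theta> \<le> pi" using m by (simp add: \<theta>_def)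
  qed (use \<theta> in auto)
  have "simple_root i = lincomb (1 / sin \<theta>) (lincomb (sin \<theta>) (simple_root i) 0 (simple_root t)) 0 (simple_root t)"
    using sin0 by (simp add: lincomb_def fun_eq_iff)
  then have *: "wact (rev (alternating t i n)) (simple_root i) = lincomb (1 / sin \<theta>)
      (wact (rev (alternating t i n)) (lincomb (sin \<theta>) (simple_root i) 0 (simple_root t))) 0
      (wact (rev (alternating t i n)) (simple_root t))"
    by (metis act_lincomb)
  show ?thesis
  proof (cases "even n")
    case True
    show ?thesis
      by (rule that[of "sin (Suc n * \<theta>) / sin \<theta>" "sin (n * \<theta>) / sin \<theta>"])
        (use sin0 sin[of n] sin[of "Suc n"] assms True
          in \<open>simp_all add: * alternating_circle[OF assms(1-3) \<theta>_def] del: of_nat_Suc,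
             simp add: lincomb_def fun_eq_iff add_divide_distrib\<close>)
  next
    case False
    show ?thesis
      by (rule that[of "sin (n * \<theta>) / sin \<theta>" "sin (Suc n * \<theta>) / sin \<theta>"])
        (use sin0 sin[of n] sin[of "Suc n"] assms False
          in \<open>simp_all add: * alternating_circle[OF assms(1-3) \<theta>_def] del: of_nat_Suc,
             simp add: lincomb_def fun_eq_iff add_divide_distrib\<close>)
  qed
qed

text \<open>A word in two letters alternates or has two equal neighbours, which cancel.  The last letter is what
  matters later, hence the reversed alternating words.\<close>

lemma dihedral_word_cases:
  assumes "q \<in> lists {i, j}" "i \<in> I" "j \<in> I"
  shows "(\<exists>n. q = rev (alternating j i n)) \<or> (\<exists>n. q = rev (alternating i j n)) \<or>
    (\<exists>q'\<in>lists {i, j}. length q' < length q \<and> val q' = val q)"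
  using assms(1)
proof (induction q)
  case Nil
  then show ?case by (intro disjI1 exI[of _ 0]) simp
next
  case (Cons a q)
  have alt: "(\<exists>n. a # rev (alternating x y n) = rev (alternating x y n)) \<or>
     (\<exists>n. a # rev (alternating x y k) = rev (alternating x y n)) \<or>
     (\<exists>n. a # rev (alternating x y k) = rev (alternating y x n)) \<or>
     (\<exists>q'\<in>lists {x, y}. length q' < Suc k \<and> val q' = val (a # rev (alternating x y k)))"
    if xy: "a = x \<or> a = y" "x \<in> I" "y \<in> I" for x y k
  proof (cases "a = (if even k then x else y)")
    case True
    then have "a # rev (alternating x y k) = rev (alternating x y (Suc k))"
      by (simp add: alternating_snoc del: alternating.simps)
    then show ?thesis by blast
  next
    case False
    show ?thesis
    proof (cases k)
      case 0
      then have "a # rev (alternating x y k) = rev (alternating y x 1)"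
        using False xy by auto
      then show ?thesis by blast
    next
      case (Suc l)
      then have "rev (alternating x y k) = a # rev (alternating x y l)"
        using False xy by (auto simp: alternating_snoc simp del: alternating.simps)
      moreover have "alternating x y l \<in> lists I" "alternating x y l \<in> lists {x, y}"
        using xy by (auto intro: alternating_lists)
      ultimately show ?thesis
        using xy Suc by (intro disjI2 bexI[of _ "rev (alternating x y l)"]) auto
    qed
  qed
  have a: "a = i \<or> a = j" "a \<in> I" using Cons.hyps assms by auto
  have com: "{i, j} = {j, i}" by auto
  consider k where "q = rev (alternating j i k)" | k where "q = rev (alternating i j k)"
    | q' where "q' \<in> lists {i, j}" "length q' < length q" "val q' = val q"
    using Cons by auto
  then show ?case
  proof cases
    case (1 k)
    then show ?thesis using alt[of j i k] a assms unfolding com by auto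
  next
    case (2 k)
    then show ?thesis using alt[of i j k] a assms by auto
  next
    case (3 q')
    then show ?thesis
      using a by (intro disjI2 bexI[of _ "a # q'"]) auto
  qed
qed

lemma len_val_append_le:
  "v \<in> carrier G \<Longrightarrow> q \<in> lists I \<Longrightarrow> len (v \<otimes> val q) \<le> len v + length q"
  using len_mult_le[of v "val q"] len_val_le[of q] by auto

text \<open>Induction on the length of \<open>g\<close>.  If \<open>t\<close> is a right descent of \<open>g\<close>, split off from \<open>g\<close> on the right as much
  of the dihedral subgroup of \<open>i\<close> and \<open>t\<close> as possible: \<open>g = v q\<close> with lengths adding and \<open>v\<close> shortest.  Then
  \<open>v\<close> ascends at both \<open>i\<close> and \<open>t\<close>, so it maps both roots to nonnegative vectors by induction.  Moreover \<open>q\<close> is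
  an alternating word ending in \<open>t\<close> of length less than \<open>m i t\<close>, as otherwise \<open>g s\<^sub>i\<close> would be shorter than
  \<open>g\<close>; hence \<open>q\<close> maps the root of \<open>i\<close> to a nonnegative combination of the two roots.\<close>

lemma root_nonneg:
  assumes "g \<in> carrier G" "i \<in> I" "len (g \<otimes> s i) = Suc (len g)"
  shows "0 \<le> gact g (simple_root i) k"
  using assms
proof (induction "len g" arbitrary: g i k rule: less_induct)
  case less
  show ?case
  proof (cases "len g = 0")
    case True
    then have "g = \<one>" using less.prems len_eq_0 by blast
    then show ?thesis by (simp add: simple_root_def)
  next
    case False
    obtain u where u: "u \<in> lists I" "val u = g" "length u = len g"
      using ex_reduced_word[OF less.prems(1)] by (auto simp: reduced_word_def)
    with False obtain u' t where ut: "u = u' @ [t]" by (cases u rule: rev_cases) auto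
    then have t: "t \<in> I" and u': "u' \<in> lists I" using u by auto
    have "g = val u' \<otimes> s t" using u(2) ut t u' by (auto simp: val_append simple_closed)
    then have "g \<otimes> s t = val u'" using t u' by simp
    then have lt: "len (g \<otimes> s t) < len g"
      using len_val_le[OF u'] u(3) ut by simp
    then have ti: "i \<noteq> t" using less.prems by auto
    \<comment> \<open>The splittings \<open>g = v q\<close> with \<open>q\<close> in the dihedral subgroup and lengths adding.\<close>
    define P where "P = (\<lambda>(v, q). v \<in> carrier G \<and> q \<in> lists {i, t} \<and> g = v \<otimes> val q \<and>
       len v + length q = len g)"
    have gt: "g \<otimes> s t \<in> carrier G" "len g = Suc (len (g \<otimes> s t))"
      using less.prems t lt len_simple_right[of t g] by (auto simp: simple_closed)
    have Pt: "P (g \<otimes> s t, [t])"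
      using gt less.prems t by (simp add: P_def simple_closed)
    from ex_has_least_nat[of P, OF Pt, of "\<lambda>x. len (fst x)"]
    obtain v q where P: "P (v, q)" and least: "\<And>v' q'. P (v', q') \<Longrightarrow> len v \<le> len v'"
      by auto
    have v: "v \<in> carrier G" and q: "q \<in> lists {i, t}" and g: "g = v \<otimes> val q"
      and lens: "len v + length q = len g" using P by (auto simp: P_def)
    have qI: "q \<in> lists I" using q less.prems(2) t by (auto intro: lists_subset)
    have lv: "len v < len g" using least[OF Pt] gt by simp
    have asc: "len (v \<otimes> s a) = Suc (len v)" if a: "a = i \<or> a = t" for a
    proof (rule ccontr)
      have aI: "a \<in> I" using a less.prems t by auto
      assume "\<not> ?thesis"
      then have *: "len v = Suc (len (v \<otimes> s a))" using len_simple_right[OF aI v] by auto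
      then have "P (v \<otimes> s a, a # q)"
        using aI v qI q g lens a by (simp add: P_def simple_closed m_assoc)
      from least[OF this] * show False by simp
    qed
    have short: "Suc (length q) \<le> length q'"
      if "q' \<in> lists {i, t}" "val q' = val (q @ [i])" for q'
    proof -
      have "q' \<in> lists I" using that less.prems(2) t by (auto intro: lists_subset)
      moreover have "g \<otimes> s i = v \<otimes> val q'"
        using that g v qI less.prems(2) by (simp add: val_append m_assoc simple_closed)
      ultimately have "Suc (len g) \<le> len v + length q'"
        using less.prems(3) len_val_append_le[OF v, of q'] by simp
      then show ?thesis using lens by simp
    qed
    have i: "i \<in> I" by fact
    consider n where "q = rev (alternating t i n)" | n where "q = rev (alternating i t (Suc n))"
      | q' where "q' \<in> lists {i, t}" "length q' < length q" "val q' = val q"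
    proof -
      assume h1: "\<And>n. q = rev (alternating t i n) \<Longrightarrow> thesis"
        and h2: "\<And>n. q = rev (alternating i t (Suc n)) \<Longrightarrow> thesis"
        and h3: "\<And>q'. q' \<in> lists {i, t} \<Longrightarrow> length q' < length q \<Longrightarrow> val q' = val q \<Longrightarrow> thesis"
      from dihedral_word_cases[OF q i t] show thesis
      proof (elim disjE exE bexE conjE)
        fix n assume n: "q = rev (alternating i t n)"
        show thesis
        proof (cases n)
          case 0
          then show thesis using n h1[of 0] by simp
        next
          case (Suc k)
          then show thesis using n h2[of k] by simp
        qed
      qed (use h1 h3 in blast)+
    qed
    then show ?thesis
    proof cases
      case (1 n)
      have nm: "n < m i t"
      proof (rule ccontr)
        assume "\<not> n < m i t"
        then obtain l where n: "n = m t i + l"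
          using label_sym[OF i t] le_Suc_ex[of "m i t" n] by auto
        have split: "\<exists>r\<in>lists {x, y}. alternating x y (k + l) = alternating x y k @ r \<and> length r = l" for x y :: 'i and k
        proof (induction k arbitrary: x y)
          case 0
          then show ?case using alternating_lists[of x "{x, y}" y] by auto
        next
          case (Suc k)
          from Suc[of y x] show ?case by (auto simp: insert_commute)
        qed
        obtain r where r: "r \<in> lists {t, i}" "alternating t i n = alternating t i (m t i) @ r" "length r = l"
          using split n by blast
        have rI: "r \<in> lists I" using r i t by (auto intro: lists_subset)
        obtain k where k: "m t i = Suc k" using label_nonzero[OF t i] by (cases "m t i") auto
        \<comment> \<open>A braid move makes \<open>q\<close> end in \<open>i\<close>; this \<open>q'\<close> is what remains of \<open>q s\<^sub>i\<close>.\<close>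
        define q' where "q' = rev (alternating t i k @ r)"
        have q': "q' \<in> lists {i, t}"
          using r alternating_lists[of t "{t, i}" i k] by (simp add: q'_def insert_commute)
        have q'I: "q' \<in> lists I" using q' i t by (auto intro: lists_subset)
        have "val (alternating t i n) = val (alternating i t (m t i) @ r)"
          using r rI i t alternating_lists
          by (simp add: val_append[of "alternating t i (m t i)"] val_append[of "alternating i t (m t i)"]
              alternating_lists val_alternating_braid[of t i])
        also have "\<dots> = s i \<otimes> val (rev q')" by (simp add: k q'_def)
        finally have "s i \<otimes> val (alternating t i n) = val (rev q')"
          using i q'I by simp
        then have "inv (s i \<otimes> val (alternating t i n)) = val q'"
          using q'I by (simp add: val_rev)
        then have "val q' = val (q @ [i])"
          using i t alternating_lists[OF t i, of n]
          by (simp add: 1 val_append val_rev inv_mult_group simple_closed inv_simple)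
        from short[OF q' this] show False using r n k by (simp add: 1 q'_def)
      qed
      obtain a b where ab: "a \<ge> 0" "b \<ge> 0"
        "wact q (simple_root i) = lincomb a (simple_root i) b (simple_root t)"
        using alternating_root[OF i t ti nm] unfolding 1 by blast
      have "gact g (simple_root i) = lincomb a (gact v (simple_root i)) b (gact v (simple_root t))"
        using v qI by (simp add: g gact_mult gact_val ab(3) gact_lincomb)
      moreover have "0 \<le> gact v (simple_root i) k" "0 \<le> gact v (simple_root t) k"
        using less.hyps[OF lv v] asc i t by auto
      ultimately show ?thesis using ab by (simp add: lincomb_def)
    next
      case (2 n)
      have "alternating t i n \<in> lists I" "alternating t i n \<in> lists {i, t}"
        using i t by (auto intro: alternating_lists)
      then have "Suc (length q) \<le> length (rev (alternating t i n))"
        using i by (intro short) (simp_all add: 2 val_append simple_closed m_assoc)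
      then show ?thesis by (simp add: 2)
    next
      case (3 q')
      have q'I: "q' \<in> lists I" using 3 i t by (auto intro: lists_subset)
      have "len g \<le> len v + length q'" using len_val_append_le[OF v q'I] 3 g by simp
      then show ?thesis using 3 lens by simp
    qed
  qed
qed

text \<open>Passing from \<open>g\<close> to \<open>g s\<^sub>i\<close> negates the image of the root of \<open>i\<close>.\<close>

lemma root_nonpos:
  assumes "g \<in> carrier G" "i \<in> I" "len g = Suc (len (g \<otimes> s i))"
  shows "gact g (simple_root i) k \<le> 0"
proof -
  have c: "g \<otimes> s i \<in> carrier G" using assms by (simp add: simple_closed)
  have "coroot I m i (simple_root i) = 2"
    using assms(2) by (simp add: coroot_simple_root finite_index cartan_diag label_diag)
  then have "reflect I m i (simple_root i) = lincomb (- 1) (simple_root i) 0 (simple_root i)"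
    by (auto simp: reflect_def lincomb_def simple_root_def)
  then have "gact (g \<otimes> s i) (simple_root i) k = - gact g (simple_root i) k"
    using assms by (simp add: gact_mult simple_closed gact_simple gact_lincomb) (simp add: lincomb_def)
  moreover have "0 \<le> gact (g \<otimes> s i) (simple_root i) k"
    using assms c by (intro root_nonneg) auto
  ultimately show ?thesis by simp
qed

lemma root_nonzero:
  assumes "g \<in> carrier G" "i \<in> I"
  shows "\<exists>k. gact g (simple_root i) k \<noteq> 0"
proof (rule ccontr)
  assume "\<not> ?thesis"
  then have "gact g (simple_root i) = (\<lambda>k. 0)" by auto
  then have "gact (inv g) (gact g (simple_root i)) = (\<lambda>k. 0)" using assms by (simp add: gact_zero)
  then have "simple_root i i = (0 :: real)" using assms by (simp add: fun_eq_iff)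
  then show False by (simp add: simple_root_def)
qed

lemma ascent_iff:
  assumes "g \<in> carrier G" "i \<in> I"
  shows "len (g \<otimes> s i) = Suc (len g) \<longleftrightarrow> (\<forall>k. 0 \<le> gact g (simple_root i) k)"
  using len_simple_right[OF assms(2,1)] root_nonneg[OF assms] root_nonpos[OF assms]
    root_nonzero[OF assms] by (metis order_antisym)

lemma descent_iff:
  assumes "g \<in> carrier G" "i \<in> I"
  shows "len g = Suc (len (g \<otimes> s i)) \<longleftrightarrow> (\<forall>k. gact g (simple_root i) k \<le> 0)"
  using len_simple_right[OF assms(2,1)] root_nonneg[OF assms] root_nonpos[OF assms]
    root_nonzero[OF assms] by (metis order_antisym)

lemma left_sign_iff:
  fixes \<delta> :: real
  assumes "g \<in> carrier G" "i \<in> I" "\<delta> = 1 \<or> \<delta> = - 1"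
  shows "real (len (s i \<otimes> g)) = len g + \<delta> \<longleftrightarrow> (\<forall>k. 0 \<le> \<delta> * gact (inv g) (simple_root i) k)"
proof -
  have "len (s i \<otimes> g) = len (inv g \<otimes> s i)"
    using assms len_inv[of "s i \<otimes> g"] by (simp add: inv_mult_group inv_simple simple_closed)
  moreover have "len g = len (inv g)" using assms(1) by simp
  moreover have "real a = real b + 1 \<longleftrightarrow> a = Suc b" "real a = real b + - 1 \<longleftrightarrow> b = Suc a" for a b
    by linarith+
  ultimately show ?thesis
    using assms(3) ascent_iff[of "inv g" i] descent_iff[of "inv g" i] inv_closed[OF assms(1)] assms(2)
    by (elim disjE) (simp_all only: mult_1 mult_minus1 neg_0_le_iff_le)
qed

text \<open>The two extreme cases of multiplication by a parabolic subgroup: on a minimal coset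
  representative (\<open>\<delta> = 1\<close>) lengths add, on a maximal one (\<open>\<delta> = - 1\<close>) they subtract.  Prefixing a letter \<open>j\<close>
  to \<open>q\<close> raises or lowers the length according to the sign of the image of the root of \<open>j\<close> under the
  inverse of \<open>val q\<close>, which is supported on \<open>J\<close>; the inverse of \<open>b\<close> multiplies that sign by \<open>\<delta>\<close>.\<close>

lemma len_parabolic_mult:
  fixes \<delta> :: real
  assumes "J \<subseteq> I" "b \<in> carrier G" "q \<in> lists J" and \<delta>: "\<delta> = 1 \<or> \<delta> = - 1"
    and sgn: "\<And>j. j \<in> J \<Longrightarrow> real (len (s j \<otimes> b)) = len b + \<delta>"
  shows "real (len (val q \<otimes> b)) = len b + \<delta> * len (val q)"
  using assms(3)
proof (induction q)
  case Nil
  then show ?case using assms by simp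
next
  case (Cons j q)
  have j: "j \<in> J" "j \<in> I" and q: "q \<in> lists J" "q \<in> lists I"
    using Cons.hyps assms(1) by (auto intro: lists_subset)
  define p where "p = val q"
  have p: "p \<in> carrier G" using q by (simp add: p_def)
  have supp: "gact (inv p) (simple_root j) k = 0" if "k \<notin> J" for k
    using wact_support[of "rev q" J j k] that q j gact_val[of "rev q" "simple_root j"]
    by (simp add: p_def val_rev)
  have fin: "finite J" using assms(1) finite_index finite_subset by blast
  have roots: "0 \<le> \<delta> * gact (inv b) (simple_root i) k" if "i \<in> J" for i k
    using left_sign_iff[OF assms(2) _ \<delta>, of i] sgn[OF that] assms(1) that by blast
  have eq: "gact (inv (p \<otimes> b)) (simple_root j) = gact (inv b) (gact (inv p) (simple_root j))"
    using p assms(2) by (simp add: inv_mult_group gact_mult)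
  obtain \<epsilon> :: real where \<epsilon>: "\<epsilon> = 1 \<or> \<epsilon> = - 1" "real (len (s j \<otimes> p)) = len p + \<epsilon>"
    using len_simple_left[OF j(2) p] that[of 1] that[of "- 1"] by auto
  have "0 \<le> \<epsilon> * gact (inv p) (simple_root j) k" for k
    using left_sign_iff[OF p j(2) \<epsilon>(1)] \<epsilon>(2) by blast
  then have "0 \<le> \<epsilon> * \<delta> * gact (inv (p \<otimes> b)) (simple_root j) k" for k
    unfolding eq using fin supp assms(2) roots by (intro gact_sign[of J]) auto
  then have "real (len (s j \<otimes> (p \<otimes> b))) = len (p \<otimes> b) + \<epsilon> * \<delta>"
    using left_sign_iff[of "p \<otimes> b" j "\<epsilon> * \<delta>"] p assms(2) j(2) \<epsilon>(1) \<delta> by auto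
  then show ?case
    using Cons.IH \<epsilon>(2) p assms(2) j
    by (simp add: m_assoc simple_closed algebra_simps flip: p_def)
qed

end


section \<open>Reduced words\<close>

context finite_label_coxeter_system
begin

lemma reduced_wordD:
  "reduced_word u g \<Longrightarrow> u \<in> lists I" "reduced_word u g \<Longrightarrow> val u = g"
  "reduced_word u g \<Longrightarrow> length u = len g" "reduced_word u g \<Longrightarrow> g \<in> carrier G"
  by (auto simp: reduced_word_def)

lemma reduced_word_appendI:
  assumes "reduced_word u g" "reduced_word v h" "len (g \<otimes> h) = len g + len h"
  shows "reduced_word (u @ v) (g \<otimes> h)"
  using assms by (auto simp: reduced_word_def val_append)

lemma reduced_word_rev: "reduced_word u g \<Longrightarrow> reduced_word (rev u) (inv g)"
  by (auto simp: reduced_word_def val_rev)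

lemma reduced_word_tail:
  assumes "reduced_word (i # u) g"
  shows "i \<in> I" "reduced_word u (s i \<otimes> g)" "len g = Suc (len (s i \<otimes> g))"
proof -
  from assms have i: "i \<in> I" and u: "u \<in> lists I" and g: "g = s i \<otimes> val u" "len g = Suc (length u)"
    by (auto simp: reduced_word_def)
  show "i \<in> I" by fact
  have eq: "s i \<otimes> g = val u" using i u by (simp add: g)
  have gc: "g \<in> carrier G" using assms by (rule reduced_wordD)
  have "len (val u) \<le> length u" using u by (rule len_val_le)
  then have "len g = Suc (len (val u))" using len_simple_left[OF i gc] g(2) unfolding eq by auto
  then show "reduced_word u (s i \<otimes> g)" "len g = Suc (len (s i \<otimes> g))"
    using g(2) u unfolding eq by (auto simp: reduced_word_def)
qed

lemma reduced_word_ConsI: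
  assumes "reduced_word u g" "i \<in> I" "len (s i \<otimes> g) = Suc (len g)"
  shows "reduced_word (i # u) (s i \<otimes> g)"
  using assms by (auto simp: reduced_word_def)

lemma len_alternating:
  assumes "i \<in> I" "j \<in> I" "i \<noteq> j" "n \<le> m i j"
  shows "len (val (alternating i j n)) = n"
  using assms
proof (induction n arbitrary: i j)
  case 0
  then show ?case by simp
next
  case (Suc n)
  have l: "alternating j i n \<in> lists I" using Suc.prems by (simp add: alternating_lists)
  have n: "n < m i j" "n < m j i" using Suc.prems label_sym[of i j] by auto
  obtain a b where ab: "a \<ge> 0" "b \<ge> 0"
    "wact (rev (alternating j i n)) (simple_root i) = lincomb a (simple_root i) b (simple_root j)"
    using alternating_root[OF Suc.prems(1-3) n(1)] by blast
  have "0 \<le> gact (inv (val (alternating j i n))) (simple_root i) k" for k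
    using l gact_val[of "rev (alternating j i n)" "simple_root i"] ab
    by (simp add: val_rev) (simp add: lincomb_def simple_root_def)
  then have "real (len (s i \<otimes> val (alternating j i n))) = len (val (alternating j i n)) + 1"
    using left_sign_iff[of "val (alternating j i n)" i 1] l Suc.prems by simp
  then show ?case using Suc.IH[of j i] Suc.prems n by simp
qed

text \<open>Matsumoto's theorem, in the form that the words are read in the 0-Hecke algebra.  If two
  reduced words of \<open>g\<close> start with different letters \<open>i\<close> and \<open>j\<close>, then \<open>g\<close> is maximal in its coset
  by the dihedral subgroup, so some reduced words of \<open>g\<close> start with the two sides of the braid
  relation and agree afterwards; the induction hypothesis compares each given word with one of
  these.\<close>

theorem hecke_word_reduced:
  assumes "reduced_word u g" "reduced_word v g"
  shows "hecke_word I m u = hecke_word I m v"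
  using assms
proof (induction "len g" arbitrary: g u v)
  case 0
  then show ?case by (auto simp: reduced_word_def)
next
  case (Suc n)
  obtain i u' where u: "u = i # u'" using Suc by (cases u) (auto simp: reduced_word_def)
  obtain j v' where v: "v = j # v'" using Suc by (cases v) (auto simp: reduced_word_def)
  have g: "g \<in> carrier G" using Suc.prems by (auto dest: reduced_wordD)
  note i = reduced_word_tail[OF Suc.prems(1)[unfolded u]]
  note j = reduced_word_tail[OF Suc.prems(2)[unfolded v]]
  have same_head: "hecke_word I m (k # x) = hecke_word I m (k # y)"
    if "reduced_word (k # x) g" "reduced_word (k # y) g" for k x y
  proof -
    note x = reduced_word_tail[OF that(1)] and y = reduced_word_tail[OF that(2)]
    have "n = len (s k \<otimes> g)" using x(3) Suc.hyps(2) by simp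
    then have "hecke_word I m x = hecke_word I m y" using x(2) y(2) by (rule Suc.hyps(1))
    then show ?thesis by simp
  qed
  show ?case
  proof (cases "i = j")
    case True
    then show ?thesis using same_head Suc.prems unfolding u v by blast
  next
    case False
    define d where "d = alternating i j (m i j)"
    have d: "d \<in> lists {i, j}" "d \<in> lists I" using i(1) j(1) by (auto simp: d_def intro: alternating_lists)
    have d_len: "len (val d) = m i j" using len_alternating[of i j "m i j"] i(1) j(1) False by (simp add: d_def)
    define z where "z = val (rev d) \<otimes> g"
    have z: "z \<in> carrier G" using d g by (simp add: z_def)
    have "real (len z) = real (len g) + (- 1) * real (len (val (rev d)))"
      unfolding z_def
      by (rule len_parabolic_mult[of "{i, j}"]) (use i(1,3) j(1,3) g d in \<open>auto\<close>)
    then have z_len: "len g = m i j + len z" using d d_len by (simp add: val_rev)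
    obtain r where r: "reduced_word r z" using ex_reduced_word[OF z] by blast
    have rI: "r \<in> lists I" using r by (rule reduced_wordD)
    have gz: "g = val d \<otimes> z" using g d by (simp add: z_def val_rev flip: m_assoc)
    have red: "reduced_word (w @ r) g" if "w \<in> lists I" "val w = val d" "length w = m i j" for w
      using that r g z_len by (auto simp: reduced_word_def val_append gz)
    have d': "alternating j i (m i j) \<in> lists I" "val (alternating j i (m i j)) = val d"
      using i(1) j(1) val_alternating_braid[of i j] by (simp_all add: alternating_lists d_def)
    obtain l where l: "m i j = Suc l" using label_nonzero[OF i(1) j(1)] by (cases "m i j") auto
    have "hecke_word I m u = hecke_word I m (d @ r)"
      using same_head[of i u' "alternating j i l @ r"] Suc.prems(1) red[OF d(2)]
      by (simp add: u d_def l)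
    also have "\<dots> = hecke_word I m (alternating j i (m i j) @ r)"
      unfolding d_def
      by (rule hecke_word_cong)
        (rule hecke_word_braid i(1) j(1) False HOL.refl d(2)[unfolded d_def] rI d'(1))+
    also have "\<dots> = hecke_word I m v"
      using same_head[of j "alternating i j l @ r" v'] Suc.prems(2) red[OF d']
      by (simp add: v l)
    finally show ?thesis .
  qed
qed

text \<open>Prefixing a letter to a reduced word yields a reduced word or, by Matsumoto's theorem, a word that can
  be rewritten so that the letter occurs twice at its start and is absorbed by idempotency.\<close>

lemma hecke_word_ex_reduced:
  assumes "u \<in> lists I"
  shows "\<exists>v. reduced_word v (val v) \<and> hecke_word I m u = hecke_word I m v"
  using assms
proof (induction u rule: list.induct)
  case Nil
  show ?case by (rule exI[of _ "[]"]) (simp add: reduced_word_def)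
next
  case (Cons i u)
  then obtain v where v: "reduced_word v (val v)" "hecke_word I m u = hecke_word I m v"
    by auto
  have i: "i \<in> I" using Cons.prems by simp
  have c: "val v \<in> carrier G" using v by (auto dest: reduced_wordD)
  from len_simple_left[OF i c] show ?case
  proof
    assume "len (s i \<otimes> val v) = Suc (len (val v))"
    then have "reduced_word (i # v) (val (i # v))" using reduced_word_ConsI[OF v(1) i] by simp
    then show ?case using v(2) by (intro exI[of _ "i # v"]) simp
  next
    assume *: "len (val v) = Suc (len (s i \<otimes> val v))"
    obtain w where w: "reduced_word w (s i \<otimes> val v)"
      using ex_reduced_word i c by (meson m_closed simple_closed)
    have iw: "reduced_word (i # w) (val v)"
      using reduced_word_ConsI[OF w i] i c * by simp
    have vw: "hecke_word I m v = hecke_word I m (i # w)"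
      using hecke_word_reduced[OF v(1) iw] .
    have wl: "w \<in> lists I" "v \<in> lists I" using w v reduced_wordD(1) by auto
    have "hecke_word I m (i # u) = hecke_word I m ([i] @ i # w)"
      using v(2) vw by simp
    also have "\<dots> = hecke_word I m ([i, i] @ w)" by simp
    also have "\<dots> = hecke_word I m ([i] @ w)"
      by (rule hecke_word_cong) (use i wl in \<open>simp_all add: hecke_word_idem del: word_val_Cons\<close>)
    also have "\<dots> = hecke_word I m v" using vw by simp
    finally show ?case using v(1) by blast
  qed
qed

end


section \<open>Subwords\<close>

lemma subseq_lists: "subseq v u \<Longrightarrow> u \<in> lists I \<Longrightarrow> v \<in> lists I"
  by (induction rule: list_emb.induct) auto

context coxeter_system
begin

text \<open>For a reduced word of \<open>w\<close> this is the Bruhat interval below \<open>w\<close>.\<close>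

definition subword_vals :: "'i list \<Rightarrow> 'a set" where
  "subword_vals u = val ` {v. subseq v u}"

lemma subword_vals_self: "val u \<in> subword_vals u"
  by (auto simp: subword_vals_def)

lemma subword_vals_one: "\<one> \<in> subword_vals u"
  unfolding subword_vals_def by (rule image_eqI[of _ _ "[]"]) auto

lemma subword_vals_subseq: "subseq v u \<Longrightarrow> subword_vals v \<subseteq> subword_vals u"
  unfolding subword_vals_def using subseq_order.trans by blast

lemma subword_vals_append:
  assumes "u \<in> lists I" "v \<in> lists I"
  shows "subword_vals (u @ v) = subword_vals u <#> subword_vals v"
proof -
  have "val (x @ y) = val x \<otimes> val y" if "subseq x u" "subseq y v" for x y
    by (rule val_append[OF subseq_lists[OF that(1) assms(1)] subseq_lists[OF that(2) assms(2)]])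
  moreover have "{w. subseq w (u @ v)} = (\<Union>x\<in>{x. subseq x u}. \<Union>y\<in>{y. subseq y v}. {x @ y})"
    by (auto simp: subseq_append_iff)
  then have "subword_vals (u @ v) = (\<Union>x\<in>{x. subseq x u}. \<Union>y\<in>{y. subseq y v}. {val (x @ y)})"
    unfolding subword_vals_def by (simp only: image_UN image_insert image_empty)
  ultimately show ?thesis
    unfolding subword_vals_def set_mult_def by simp
qed

lemma subword_vals_single: "i \<in> I \<Longrightarrow> subword_vals [i] = {\<one>, s i}"
proof -
  assume "i \<in> I"
  moreover have "{v. subseq v [i]} = {[], [i]}"
    by (auto elim: list_emb.cases)
  ultimately show ?thesis by (simp add: subword_vals_def simple_closed)
qed

lemma subword_vals_idem:
  assumes "i \<in> I"
  shows "subword_vals [i, i] = subword_vals [i]"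
proof -
  have "subword_vals [i, i] = {\<one>, s i} <#> {\<one>, s i}"
    using subword_vals_append[of "[i]" "[i]"] subword_vals_single[OF assms] assms by simp
  also have "\<dots> = {\<one>, s i}" using assms by (auto simp: set_mult_def simple_closed)
  finally show ?thesis using subword_vals_single[OF assms] by simp
qed

lemma subword_vals_in_parabolic:
  "u \<in> lists J \<Longrightarrow> subword_vals u \<subseteq> val ` lists J"
  using subseq_lists unfolding subword_vals_def by blast

end

context finite_label_coxeter_system
begin

text \<open>Both sides of a braid relation have the whole dihedral group as their set of subword values,
  since every element of that group has an alternating word of length at most \<open>m i j\<close>.\<close>

lemma subword_vals_alternating:
  assumes "i \<in> I" "j \<in> I" "i \<noteq> j"
  shows "subword_vals (alternating i j (m i j)) = val ` lists {i, j}"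
proof
  show "subword_vals (alternating i j (m i j)) \<subseteq> val ` lists {i, j}"
    by (rule subword_vals_in_parabolic) (simp add: alternating_lists)
  define E where "E = {val (alternating i j n) | n. n \<le> m i j} \<union> {val (alternating j i n) | n. n \<le> m i j}"
  have m_pos: "m i j \<ge> 1" using label_nonzero assms by (simp add: Suc_leI)
  have braid: "val (alternating i j (m i j)) = val (alternating j i (m i j))"
    by (rule val_alternating_braid[OF assms(1,2)])
  have EI: "val (alternating x y n) \<in> E" if "{x, y} = {i, j}" "n \<le> m i j" for x y n
  proof -
    consider "x = i" "y = j" | "x = j" "y = i"
      using \<open>{x, y} = {i, j}\<close> by (auto simp: doubleton_eq_iff)
    then show ?thesis unfolding E_def using that(2) by cases blast+
  qed
  have altI: "alternating x y n \<in> lists I" if "{x, y} = {i, j}" for x y n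
    using that assms by (intro alternating_lists) auto
  have step: "s x \<otimes> val (alternating a b n) \<in> E"
    if xy: "{x, y} = {i, j}" "x \<noteq> y" "{a, b} = {i, j}" "a \<noteq> b" "n \<le> m i j" for x y a b n
  proof -
    have xI: "x \<in> I" using that assms by auto
    have down: "s x \<otimes> val (alternating x y n) \<in> E" if n: "n \<le> m i j" for n
    proof (cases n)
      case 0
      then have "s x \<otimes> val (alternating x y n) = val (alternating x y 1)" by simp
      then show ?thesis using EI[OF \<open>{x, y} = {i, j}\<close> m_pos] by simp
    next
      case (Suc k)
      then have "s x \<otimes> val (alternating x y n) = val (alternating y x k)"
        using xI altI[of y x k] \<open>{x, y} = {i, j}\<close> by (simp add: insert_commute)
      then show ?thesis using EI[of y x k] \<open>{x, y} = {i, j}\<close> n Suc by (simp add: insert_commute)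
    qed
    consider "a = x" "b = y" | "a = y" "b = x"
      using \<open>{x, y} = {i, j}\<close> \<open>{a, b} = {i, j}\<close> by (auto simp: doubleton_eq_iff)
    then show ?thesis
    proof cases
      case 1
      then show ?thesis using down that by simp
    next
      case 2
      show ?thesis
      proof (cases "n = m i j")
        case True
        have "val (alternating a b n) = val (alternating x y n)"
          using braid that(1) unfolding True 2 doubleton_eq_iff by auto
        then show ?thesis using down that(5) by simp
      next
        case False
        then have "Suc n \<le> m i j" using that(5) by simp
        then show ?thesis using EI[OF xy(1), of "Suc n"] by (simp add: 2)
      qed
    qed
  qed
  have in_E: "val q \<in> E" if "q \<in> lists {i, j}" for q
    using that
  proof (induction q rule: list.induct)
    case Nil
    then show ?case unfolding E_def by (auto intro!: exI[of _ 0])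
  next
    case (Cons x q)
    then have "val q \<in> E" "x = i \<or> x = j" by auto
    then obtain a b n where n: "val q = val (alternating a b n)" "n \<le> m i j" "{a, b} = {i, j}" "a \<noteq> b"
      using assms(3) unfolding E_def by auto
    have "s x \<otimes> val q \<in> E"
      using \<open>x = i \<or> x = j\<close> step[of i j a b n] step[of j i a b n] n assms(3)
      by (auto simp: insert_commute)
    then show ?case by simp
  qed
  have pre: "subseq (alternating x y n) (alternating x y k)" if "n \<le> k" for x y :: 'i and n k
    using that
  proof (induction k arbitrary: n x y)
    case (Suc k)
    then show ?case by (cases n) auto
  qed simp
  have "E \<subseteq> subword_vals (alternating i j (m i j))"
  proof
    fix g assume "g \<in> E"
    then obtain x y n where g: "g = val (alternating x y n)" "n \<le> m i j"
      and xy: "x = i \<and> y = j \<or> x = j \<and> y = i"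
      unfolding E_def by blast
    show "g \<in> subword_vals (alternating i j (m i j))"
    proof (cases "n = m i j")
      case True
      then have "g = val (alternating i j (m i j))" using g(1) braid xy by metis
      then show ?thesis by (simp add: subword_vals_self)
    next
      case False
      then obtain k where k: "m i j = Suc k" "n \<le> k" using g(2) by (cases "m i j") auto
      then have "subseq (alternating x y n) (alternating i j (m i j))"
        using pre[of n "m i j" i j] pre[of n k j i] g(2) xy by auto
      then show ?thesis unfolding subword_vals_def g(1) by blast
    qed
  qed
  then show "val ` lists {i, j} \<subseteq> subword_vals (alternating i j (m i j))" using in_E by blast
qed

lemma subword_vals_hecke_word:
  assumes "u \<in> lists I" "v \<in> lists I" "hecke_word I m u = hecke_word I m v"
  shows "subword_vals u = subword_vals v"
proof (rule hecke_word_invariant[OF _ _ _ assms, where M = "(<#>)"])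
  fix i j assume ij: "i \<in> I" "j \<in> I" "i \<noteq> j"
  show "subword_vals (alternating i j (m i j)) = subword_vals (alternating j i (m i j))"
    using subword_vals_alternating[of i j] subword_vals_alternating[of j i] ij label_sym[of i j]
    by (simp add: insert_commute)
qed (simp_all add: subword_vals_append subword_vals_idem)

lemma len_subword_val:
  assumes "u \<in> lists I" "g \<in> subword_vals u"
  shows "len g \<le> length u" "len g = length u \<Longrightarrow> g = val u"
proof -
  obtain v where v: "subseq v u" "g = val v" using assms(2) by (auto simp: subword_vals_def)
  have l: "len g \<le> length v" using v assms(1) subseq_lists len_val_le by auto
  moreover have lv: "length v \<le> length u" using v(1) by (rule list_emb_length)
  ultimately show "len g \<le> length u" by simp
  assume "len g = length u"
  then have "length v = length u" using l lv by linarith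
  then have "v = u" using v(1) by (metis subseq_same_length)
  then show "g = val u" using v(2) by simp
qed

lemma reduced_word_some: "g \<in> carrier G \<Longrightarrow> reduced_word (SOME u. reduced_word u g) g"
  by (rule someI_ex) (rule ex_reduced_word)

lemma hecke_basis_reduced: "reduced_word u g \<Longrightarrow> hecke_basis g = hecke_word I m u"
  unfolding hecke_basis_def
  by (rule hecke_word_reduced[OF reduced_word_some[OF reduced_wordD(4)]])

text \<open>Equal basis elements have equal sets of subword values, so each of \<open>g\<close> and \<open>h\<close> is the value of a
  subword of a reduced word of the other, which leaves only the whole word.\<close>

lemma hecke_basis_inj:
  assumes "g \<in> carrier G" "h \<in> carrier G" "hecke_basis g = hecke_basis h"
  shows "g = h"
proof -
  obtain u v where u: "reduced_word u g" and v: "reduced_word v h"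
    using ex_reduced_word[OF assms(1)] ex_reduced_word[OF assms(2)] by blast
  have l: "u \<in> lists I" "v \<in> lists I" using u v by (auto dest: reduced_wordD)
  have eq: "subword_vals u = subword_vals v"
    by (rule subword_vals_hecke_word[OF l
          assms(3)[unfolded hecke_basis_reduced[OF u] hecke_basis_reduced[OF v]]])
  have gv: "g \<in> subword_vals v"
    using subword_vals_self[of u] unfolding eq reduced_wordD(2)[OF u] .
  have hu: "h \<in> subword_vals u"
    using subword_vals_self[of v] unfolding eq[symmetric] reduced_wordD(2)[OF v] .
  have "len g = len h"
    using len_subword_val(1)[OF l(2) gv] len_subword_val(1)[OF l(1) hu]
      reduced_wordD(3)[OF u] reduced_wordD(3)[OF v] by simp
  then show ?thesis
    using len_subword_val(2)[OF l(2) gv] reduced_wordD(3)[OF v] unfolding reduced_wordD(2)[OF v] by simp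
qed

lemma demazure_eqI:
  assumes "z \<in> carrier G"
    "hecke_basis x \<otimes>\<^bsub>hecke_algebra I m\<^esub> hecke_basis y = hecke_basis z"
  shows "demazure x y = z"
  unfolding demazure_def
proof (rule the_equality)
  fix w assume "w \<in> carrier G \<and> hecke_basis x \<otimes>\<^bsub>hecke_algebra I m\<^esub> hecke_basis y = hecke_basis w"
  then show "w = z" using assms by (intro hecke_basis_inj) auto
qed (use assms in simp)


section \<open>Longest elements\<close>

text \<open>An element maximal in a parabolic subgroup \<open>W\<^sub>J\<close> has all of \<open>J\<close> as descents, so lengths
  subtract on multiplying by it; this makes it unique.\<close>

lemma longest_unique:
  assumes "J \<subseteq> I" "w \<in> generate G (s ` J)" "w' \<in> generate G (s ` J)"
    and max: "\<And>v. v \<in> generate G (s ` J) \<Longrightarrow> len v \<le> len w"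
    and max': "\<And>v. v \<in> generate G (s ` J) \<Longrightarrow> len v \<le> len w'"
  shows "w' = w"
proof -
  have w: "w \<in> carrier G" "w' \<in> carrier G" using assms generate_carrier by auto
  have sub: "s ` J \<subseteq> carrier G" using assms(1) simple_closed by auto
  have "w' \<otimes> inv w \<in> generate G (s ` J)"
    by (rule generate.eng[OF assms(3) generate_m_inv_closed[OF sub assms(2)]])
  then obtain q where q: "q \<in> lists J" "val q = w' \<otimes> inv w"
    using generate_simple_iff[OF assms(1)] by blast
  have "real (len (val q \<otimes> w)) = real (len w) + (- 1) * real (len (val q))"
  proof (rule len_parabolic_mult[OF assms(1) w(1) q(1)])
    fix j assume j: "j \<in> J"
    have "s j \<otimes> w \<in> generate G (s ` J)"
      by (rule generate.eng[OF generate.incl[OF imageI[OF j]] assms(2)])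
    then have "len (s j \<otimes> w) \<le> len w" by (rule max)
    moreover have "j \<in> I" using j assms(1) by blast
    ultimately show "real (len (s j \<otimes> w)) = real (len w) + - 1"
      using len_simple_left[OF _ w(1), of j] by linarith
  qed simp
  moreover have "val q \<otimes> w = w'" using q w by (simp add: m_assoc)
  ultimately have "real (len w') = real (len w) - real (len (val q))" by simp
  then have "len (val q) = 0" using max'[OF assms(2)] by linarith
  then have "w' \<otimes> inv w = \<one>" using len_eq_0[of "val q"] w unfolding q(2) by simp
  then show ?thesis using inv_equality[of w' "inv w"] w by simp
qed

context
  assumes fin: "finite (carrier G)"
begin

lemma longest_maximal:
  assumes "J \<subseteq> I"
  shows "longest J \<in> generate G (s ` J) \<and> (\<forall>v \<in> generate G (s ` J). len v \<le> len (longest J))"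
proof -
  have "generate G (s ` J) \<subseteq> carrier G" using assms generate_carrier by blast
  then have "finite (len ` generate G (s ` J))" using fin finite_subset by blast
  moreover have "len ` generate G (s ` J) \<noteq> {}" using generate.one[of G] by blast
  ultimately have "Max (len ` generate G (s ` J)) \<in> len ` generate G (s ` J)" by (rule Max_in)
  then obtain w where w: "w \<in> generate G (s ` J)" "len w = Max (len ` generate G (s ` J))" by auto
  have "len v \<le> len w" if "v \<in> generate G (s ` J)" for v
    unfolding w(2) using \<open>finite (len ` _)\<close> that by (intro Max_ge) auto
  then have "\<exists>!w. w \<in> generate G (s ` J) \<and> (\<forall>v \<in> generate G (s ` J). len v \<le> len w)"
    using w(1) longest_unique[OF assms] by blast
  then show ?thesis unfolding longest_def by (rule theI')
qed

lemma longest_generate: "J \<subseteq> I \<Longrightarrow> longest J \<in> generate G (s ` J)"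
  and longest_ge: "J \<subseteq> I \<Longrightarrow> v \<in> generate G (s ` J) \<Longrightarrow> len v \<le> len (longest J)"
  using longest_maximal by blast+

lemma longest_closed [simp]: "J \<subseteq> I \<Longrightarrow> longest J \<in> carrier G"
  using longest_generate generate_carrier by blast

lemma longest_inv: "J \<subseteq> I \<Longrightarrow> inv (longest J) = longest J"
proof -
  assume J: "J \<subseteq> I"
  have sub: "s ` J \<subseteq> carrier G" using J simple_closed by auto
  show ?thesis
    by (rule longest_unique[OF J])
      (use J longest_generate longest_ge generate_m_inv_closed[OF sub] in auto)
qed

lemma longest_sq: "J \<subseteq> I \<Longrightarrow> longest J \<otimes> longest J = \<one>"
  using longest_inv[of J] longest_closed[of J] r_inv[of "longest J"] by simp

text \<open>The case of \<open>len_parabolic_mult\<close> where the subgroup is the whole group.\<close>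

lemma len_mult_longest:
  assumes "g \<in> carrier G"
  shows "len (g \<otimes> longest I) + len g = len (longest I)"
proof -
  obtain q where q: "q \<in> lists I" "val q = g" using assms carrier_iff by blast
  have "real (len (val q \<otimes> longest I)) = real (len (longest I)) + (- 1) * real (len (val q))"
  proof (rule len_parabolic_mult[OF subset_refl longest_closed[OF subset_refl] q(1)])
    fix j assume j: "j \<in> I"
    then have "s j \<otimes> longest I \<in> generate G (s ` I)"
      unfolding generated by (simp add: simple_closed)
    then have "len (s j \<otimes> longest I) \<le> len (longest I)" by (intro longest_ge) auto
    then show "real (len (s j \<otimes> longest I)) = real (len (longest I)) + - 1"
      using len_simple_left[OF j longest_closed[OF subset_refl]] by linarith
  qed simp
  then show ?thesis unfolding q(2) by linarith
qed

lemma len_longest_mult: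
  fixes \<delta> :: real
  assumes "J \<subseteq> I" "b \<in> carrier G" "\<delta> = 1 \<or> \<delta> = - 1"
    and "\<And>j. j \<in> J \<Longrightarrow> real (len (s j \<otimes> b)) = len b + \<delta>"
  shows "real (len (longest J \<otimes> b)) = len b + \<delta> * len (longest J)"
proof -
  obtain q where "q \<in> lists J" "val q = longest J"
    using longest_generate[OF assms(1)] generate_simple_iff[OF assms(1)] by blast
  then show ?thesis using len_parabolic_mult[OF assms(1,2) _ assms(3,4)] by metis
qed

lemma longest_empty: "longest {} = \<one>"
  using longest_generate[of "{}"] generate_simple_iff[of "{}"] by auto

lemma longest_eq_one: "J \<subseteq> I \<Longrightarrow> longest J = \<one> \<Longrightarrow> J = {}"
proof (rule ccontr)
  assume J: "J \<subseteq> I" "longest J = \<one>" "J \<noteq> {}"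
  then obtain j where j: "j \<in> J" by blast
  have jI: "j \<in> I" using j J(1) by blast
  have "len (s j) \<le> len (longest J)"
    by (rule longest_ge[OF J(1) generate.incl[OF imageI[OF j]]])
  then have "len (s j) = 0" unfolding J(2) by simp
  then show False using len_val_parity[of "[j]"] jI by (simp add: simple_closed)
qed


section \<open>A criterion for an empty star product\<close>

text \<open>Let \<open>w\<^sub>0\<close> be the longest element and \<open>x = w\<^sub>0\<^sup>J w\<^sub>0\<close> for \<open>J = J\<^sub>1\<close>, the longest of the minimal
  representatives of the cosets of \<open>W\<^sub>J\<close>.  Every minimal representative \<open>b\<close> is a left factor:
  \<open>x = b b'\<close> with lengths adding, because lengths add in \<open>w\<^sub>0\<^sup>J b\<close> and any element is a left factor of
  \<open>w\<^sub>0\<close>.  So if \<open>b\<close> lies above the longest element \<open>w\<close> of the second parabolic subgroup in the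
  Bruhat order, then the subwords of a word for \<open>x\<close> followed by \<open>w w\<^sub>0\<close> include a word for
  \<open>w w w\<^sub>0 = w\<^sub>0\<close>.\<close>

lemma demazure_eq_longest:
  assumes J: "J\<^sub>1 \<subseteq> I" "J\<^sub>2 \<subseteq> I" and v: "reduced_word v b"
    and min: "\<And>j. j \<in> J\<^sub>1 \<Longrightarrow> len (s j \<otimes> b) = Suc (len b)"
    and above: "longest J\<^sub>2 \<in> subword_vals v"
  shows "demazure (longest J\<^sub>1 \<otimes> longest I) (longest J\<^sub>2 \<otimes> longest I) = longest I"
proof -
  let ?w = "longest I"
  note closed [simp] = longest_closed[OF J(1)] longest_closed[OF J(2)] longest_closed[OF subset_refl]
  have b: "b \<in> carrier G" and vl: "v \<in> lists I" using v by (auto dest: reduced_wordD)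
  define b' where "b' = inv (longest J\<^sub>1 \<otimes> b) \<otimes> ?w"
  have b': "b' \<in> carrier G" using b by (simp add: b'_def)
  have "real (len (longest J\<^sub>1 \<otimes> b)) = real (len b) + 1 * real (len (longest J\<^sub>1))"
    using min by (intro len_longest_mult[OF J(1) b]) auto
  moreover have "len b' + len (longest J\<^sub>1 \<otimes> b) = len ?w"
    using len_mult_longest[of "inv (longest J\<^sub>1 \<otimes> b)"] b by (simp add: b'_def)
  moreover have "len (longest J\<^sub>1 \<otimes> ?w) + len (longest J\<^sub>1) = len ?w"
    by (rule len_mult_longest) simp
  moreover have x: "b \<otimes> b' = longest J\<^sub>1 \<otimes> ?w"
    using b by (simp add: b'_def inv_mult_group longest_inv[OF J(1)] flip: m_assoc)
  ultimately have len: "len (b \<otimes> b') = len b + len b'" by simp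
  obtain r where r: "reduced_word r b'" using ex_reduced_word[OF b'] by blast
  obtain u where u: "reduced_word u (longest J\<^sub>2 \<otimes> ?w)"
    using ex_reduced_word[of "longest J\<^sub>2 \<otimes> ?w"] by auto
  have l: "r \<in> lists I" "u \<in> lists I" using r u by (auto dest: reduced_wordD)
  have "hecke_basis (longest J\<^sub>1 \<otimes> ?w) = hecke_word I m (v @ r)"
    using hecke_basis_reduced[OF reduced_word_appendI[OF v r len]] x by simp
  then have prod: "hecke_basis (longest J\<^sub>1 \<otimes> ?w) \<otimes>\<^bsub>hecke_algebra I m\<^esub> hecke_basis (longest J\<^sub>2 \<otimes> ?w)
      = hecke_word I m ((v @ r) @ u)"
    using hecke_basis_reduced[OF u] hecke_word_append[of "v @ r" I u] l vl by simp
  obtain z where z: "reduced_word z (val z)" "hecke_word I m ((v @ r) @ u) = hecke_word I m z"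
    using hecke_word_ex_reduced[of "(v @ r) @ u"] l vl by auto
  have zl: "z \<in> lists I" using z by (auto dest: reduced_wordD)
  have "subword_vals z = subword_vals v <#> subword_vals r <#> subword_vals u"
    using subword_vals_hecke_word[OF _ zl z(2)] l vl by (simp add: subword_vals_append del: append_assoc)
  moreover have "(longest J\<^sub>2 \<otimes> \<one>) \<otimes> (longest J\<^sub>2 \<otimes> ?w) \<in> subword_vals v <#> subword_vals r <#> subword_vals u"
  proof -
    have mult: "x \<otimes> y \<in> X <#> Y" if "x \<in> X" "y \<in> Y" for x y X Y
      using that by (auto simp: set_mult_def)
    show ?thesis
      using subword_vals_self[of u] unfolding reduced_wordD(2)[OF u]
      by (rule mult[OF mult[OF above subword_vals_one]])
  qed
  moreover have "(longest J\<^sub>2 \<otimes> \<one>) \<otimes> (longest J\<^sub>2 \<otimes> ?w) = ?w"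
    by (simp add: longest_sq[OF J(2)] flip: m_assoc)
  ultimately have w: "?w \<in> subword_vals z" by simp
  have "length z = len (val z)" using z(1) by (rule reduced_wordD)
  moreover have "len (val z) \<le> len ?w" using len_mult_longest[of "val z"] zl by simp
  ultimately have "?w = val z" using len_subword_val[OF zl w] by simp
  then have "hecke_basis ?w = hecke_word I m z" using hecke_basis_reduced[OF z(1)] by simp
  then show ?thesis using prod z(2) by (intro demazure_eqI) simp_all
qed

text \<open>As \<open>g\<close> descends at all of \<open>J\<close>, it factors as \<open>g = a w\<close> with \<open>w\<close> the longest element of \<open>W\<^sub>J\<close> and lengths
  adding.  So \<open>w\<close> is the value of a subword of one reduced word of \<open>g\<close>, hence of all of them.\<close>

lemma longest_in_subword_vals:
  assumes J: "J \<subseteq> I" and q: "reduced_word q g" "subseq q v"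
    and max: "\<And>j. j \<in> J \<Longrightarrow> len g = Suc (len (g \<otimes> s j))"
  shows "longest J \<in> subword_vals v"
proof -
  let ?w = "longest J"
  note closed [simp] = longest_closed[OF J]
  have g: "g \<in> carrier G" and ql: "q \<in> lists I" using q by (auto dest: reduced_wordD)
  define a where "a = ?w \<otimes> inv g"
  have a: "a \<in> carrier G" using g by (simp add: a_def)
  have "real (len (?w \<otimes> inv g)) = real (len (inv g)) + (- 1) * real (len ?w)"
  proof (rule len_longest_mult[OF J])
    fix j assume j: "j \<in> J"
    then have jI: "j \<in> I" using J by blast
    have "inv (g \<otimes> s j) = s j \<otimes> inv g" using g jI by (simp add: inv_mult_group inv_simple simple_closed)
    then have "len (s j \<otimes> inv g) = len (g \<otimes> s j)" using g jI len_inv[of "g \<otimes> s j"] by (simp add: simple_closed)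
    then show "real (len (s j \<otimes> inv g)) = real (len (inv g)) + - 1" using max[OF j] g by simp
  qed (use g in auto)
  then have la: "real (len a) = real (len g) - real (len ?w)" using g by (simp add: a_def)
  have ga: "inv a \<otimes> ?w = g"
    using g by (simp add: a_def inv_mult_group longest_inv[OF J] m_assoc longest_sq[OF J])
  have len: "len (inv a \<otimes> ?w) = len (inv a) + len ?w"
    unfolding ga len_inv[OF a] using la by linarith
  obtain x y where x: "reduced_word x (inv a)" and y: "reduced_word y ?w"
    using ex_reduced_word[of "inv a"] ex_reduced_word[of ?w] a by auto
  have l: "x \<in> lists I" "y \<in> lists I" using x y by (auto dest: reduced_wordD)
  have "hecke_word I m (x @ y) = hecke_word I m q"
    using hecke_word_reduced[OF reduced_word_appendI[OF x y len]] q(1) ga by simp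
  then have "subword_vals (x @ y) = subword_vals q"
    using l ql by (intro subword_vals_hecke_word) auto
  moreover have "?w \<in> subword_vals (x @ y)"
    using subword_vals_subseq[of y "x @ y"] subword_vals_self[of y] reduced_wordD(2)[OF y] by auto
  ultimately show ?thesis using subword_vals_subseq[OF q(2)] by auto
qed

lemma star_eq_empty:
  assumes J: "J\<^sub>1 \<subseteq> I" "J\<^sub>2 \<subseteq> I" and v: "reduced_word v b"
    and min: "\<And>j. j \<in> J\<^sub>1 \<Longrightarrow> len (s j \<otimes> b) = Suc (len b)"
    and q: "reduced_word q g" "subseq q v"
    and max: "\<And>j. j \<in> J\<^sub>2 \<Longrightarrow> len g = Suc (len (g \<otimes> s j))"
  shows "star J\<^sub>1 J\<^sub>2 = {}"
proof -
  have "demazure (longest J\<^sub>1 \<otimes> longest I) (longest J\<^sub>2 \<otimes> longest I) = longest I"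
    using longest_in_subword_vals[OF J(2) q max]
    by (intro demazure_eq_longest[OF J v min])
  moreover have "longest I = longest K \<otimes> longest I \<longleftrightarrow> K = {}" if "K \<subseteq> I" for K
    using that longest_eq_one[of K] longest_empty l_cancel_one'[of "longest I" "longest K"] by auto
  ultimately show ?thesis
    unfolding star_def by (intro the_equality) auto
qed

end

end


section \<open>Computing with roots\<close>

text \<open>The pair \<open>(a, b)\<close> stands for \<open>a + b \<theta>\<close>, where \<open>\<theta> \<ge> 0\<close> and \<open>\<theta>\<^sup>2 = p \<theta> + q\<close>.  Nonnegative \<open>a\<close> and \<open>b\<close> certify
  a nonnegative number; this sufficient condition is met by the positive roots that occur.\<close>

type_synonym quad = "int \<times> int"

definition quad_eval :: "real \<Rightarrow> quad \<Rightarrow> real" where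
  "quad_eval \<theta> x = of_int (fst x) + of_int (snd x) * \<theta>"

definition quad_add :: "quad \<Rightarrow> quad \<Rightarrow> quad" where
  "quad_add x y = (fst x + fst y, snd x + snd y)"

definition quad_neg :: "quad \<Rightarrow> quad" where
  "quad_neg x = (- fst x, - snd x)"

definition quad_scale :: "int \<Rightarrow> int \<Rightarrow> bool \<Rightarrow> quad \<Rightarrow> quad" where
  "quad_scale p q h x = (if h then (q * snd x, fst x + p * snd x) else x)"

definition all_nonneg :: "quad list \<Rightarrow> bool" where
  "all_nonneg v \<longleftrightarrow> list_all (\<lambda>x. 0 \<le> fst x \<and> 0 \<le> snd x) v"

definition all_nonpos :: "quad list \<Rightarrow> bool" where
  "all_nonpos v \<longleftrightarrow> list_all (\<lambda>x. fst x \<le> 0 \<and> snd x \<le> 0) v"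

text \<open>The list \<open>C\<close> holds the images of the simple roots of a path diagram under some group element \<open>g\<close>; the
  result holds their images under \<open>g s\<^sub>k\<close>.  The entry \<open>hs ! k\<close> tells whether the edge from \<open>k\<close> to \<open>Suc k\<close> has
  \<open>2 cos (pi / m) = \<theta>\<close> rather than \<open>1\<close>.\<close>

definition step :: "int \<Rightarrow> int \<Rightarrow> bool list \<Rightarrow> nat \<Rightarrow> quad list list \<Rightarrow> quad list list" where
  "step p q hs k C = map (\<lambda>i.
     if i = k then map quad_neg (C ! k)
     else if i = Suc k \<or> k = Suc i
       then map2 quad_add (C ! i) (map (quad_scale p q (hs ! min i k)) (C ! k))
     else C ! i) [0..<length C]"

text \<open>Multiplication on the right by the letters of a word, as long as each of them increases the length.\<close>

primrec ascend :: "int \<Rightarrow> int \<Rightarrow> bool list \<Rightarrow> quad list list \<Rightarrow> nat list \<Rightarrow> quad list list option" where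
  "ascend p q hs C [] = Some C"
| "ascend p q hs C (k # u) = (if all_nonneg (C ! k) then ascend p q hs (step p q hs k C) u else None)"

text \<open>Multiplication by those letters other than \<open>j\<close> that increase the length: the product of the letters other
  than \<open>j\<close> in the 0-Hecke monoid.\<close>

primrec greedy :: "int \<Rightarrow> int \<Rightarrow> bool list \<Rightarrow> nat \<Rightarrow> quad list list \<Rightarrow> nat list \<Rightarrow> quad list list" where
  "greedy p q hs j C [] = C"
| "greedy p q hs j C (k # u) =
     (if k \<noteq> j \<and> all_nonneg (C ! k) then greedy p q hs j (step p q hs k C) u
      else greedy p q hs j C u)"

definition simple_roots :: "nat \<Rightarrow> quad list list" where
  "simple_roots n = map (\<lambda>i. map (\<lambda>l. (if l = i then 1 else 0, 0)) [0..<n]) [0..<n]"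

text \<open>The value \<open>b\<close> of \<open>w\<close> is a minimal coset representative for the complement of \<open>i\<close>, and for every \<open>k\<close>
  some subword of \<open>w\<close> is a reduced word of an element that descends at all nodes except possibly \<open>k\<close>.  Left
  descents of \<open>b\<close> are visible in the images of the simple roots under the inverse of \<open>b\<close>, hence the reversal of
  \<open>w\<close>.\<close>

definition certificate :: "int \<Rightarrow> int \<Rightarrow> bool list \<Rightarrow> nat \<Rightarrow> nat list \<Rightarrow> bool" where
  "certificate p q hs i w \<longleftrightarrow>
     (let n = Suc (length hs) in
      list_all (\<lambda>k. k < n) w \<and>
      (case ascend p q hs (simple_roots n) (rev w) of
         None \<Rightarrow> False
       | Some C \<Rightarrow> list_all (\<lambda>j. j = i \<or> all_nonneg (C ! j)) [0..<n]) \<and>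
      list_all (\<lambda>k. let C = greedy p q hs k (simple_roots n) w in
         list_all (\<lambda>j. j = k \<or> all_nonpos (C ! j)) [0..<n]) [0..<n])"

lemma certificateD:
  assumes "certificate p q hs i w" and n: "n = Suc (length hs)"
  shows "list_all (\<lambda>k. k < n) w"
    and "\<exists>C. ascend p q hs (simple_roots n) (rev w) = Some C \<and> (\<forall>j < n. j \<noteq> i \<longrightarrow> all_nonneg (C ! j))"
    and "k < n \<Longrightarrow> j < n \<Longrightarrow> j \<noteq> k \<Longrightarrow> all_nonpos (greedy p q hs k (simple_roots n) w ! j)"
  using assms(1) unfolding certificate_def n[symmetric] Let_def
  by (auto simp: list_all_iff Ball_def split: option.splits)

text \<open>Each word below is an initial segment of a reduced word of \<open>w\<^sub>J w\<^sub>0\<close>, where \<open>J\<close> is the complement of \<open>i\<close>,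
  long enough for the longest elements of all maximal parabolic subgroups to occur in it.\<close>

lemma ex_certificate_H3: "i < 3 \<Longrightarrow> \<exists>w. certificate 1 1 [True, False] i w"
proof -
  have certs:
    "certificate 1 1 [True, False] 0 [0, 1, 0, 2, 1, 2, 0, 1, 0]"
    "certificate 1 1 [True, False] 1 [1, 0, 1, 2, 1, 0, 1, 2, 0]"
    "certificate 1 1 [True, False] 2 [2, 1, 0, 1, 0, 2, 1, 0, 1]"
    by code_simp+
  assume "i < 3"
  then have "i = 0 \<or> i = 1 \<or> i = 2" by linarith
  then show ?thesis using certs by (elim disjE) (hypsubst, blast)+
qed

lemma ex_certificate_H4: "i < 4 \<Longrightarrow> \<exists>w. certificate 1 1 [True, False, False] i w"
proof -
  have certs:
    "certificate 1 1 [True, False, False] 0 [0, 1, 0, 2, 3, 1, 2, 3, 0, 1, 2, 0, 1, 0, 2, 1, 2]"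
    "certificate 1 1 [True, False, False] 1 [1, 0, 1, 2, 1, 0, 1, 0, 3, 2, 1, 0, 2, 1, 2, 0]"
    "certificate 1 1 [True, False, False] 2 [2, 1, 3, 2, 0, 1, 2, 3, 0, 1, 2, 0, 1, 0, 2, 1, 0]"
    "certificate 1 1 [True, False, False] 3 [3, 2, 1, 0, 1, 2, 3, 0, 1, 2, 0, 1, 0, 2, 1, 2, 0, 1]"
    by code_simp+
  assume "i < 4"
  then have "i = 0 \<or> i = 1 \<or> i = 2 \<or> i = 3" by linarith
  then show ?thesis using certs by (elim disjE) (hypsubst, blast)+
qed

lemma ex_certificate_F4: "i < 4 \<Longrightarrow> \<exists>w. certificate 0 2 [False, True, False] i w"
proof -
  have certs:
    "certificate 0 2 [False, True, False] 0 [0, 1, 2, 3, 1, 0, 2, 1, 0, 2, 3, 1, 2]"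
    "certificate 0 2 [False, True, False] 1 [1, 2, 1, 0, 3, 1, 2, 3, 1, 0, 2, 3]"
    "certificate 0 2 [False, True, False] 2 [2, 1, 0, 2, 1, 3, 2, 1, 0, 2, 3, 1]"
    "certificate 0 2 [False, True, False] 3 [3, 2, 1, 0, 2, 3, 1, 2, 3, 1, 2, 0, 1]"
    by code_simp+
  assume "i < 4"
  then have "i = 0 \<or> i = 1 \<or> i = 2 \<or> i = 3" by linarith
  then show ?thesis using certs by (elim disjE) (hypsubst, blast)+
qed

locale path_coxeter_system = finite_label_coxeter_system G I s m
  for G (structure) and I :: "'i set" and s :: "'i \<Rightarrow> 'a" and m +
  fixes xs :: "'i list" and hs :: "bool list" and \<theta> :: real and p q :: int
  assumes distinct_nodes: "distinct xs" and nodes: "set xs = I"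
    and length_nodes: "length xs = Suc (length hs)"
    and adjacent: "k < length hs \<Longrightarrow> 2 * cos (pi / m (xs ! k) (xs ! Suc k)) = (if hs ! k then \<theta> else 1)"
    and distant: "Suc k < l \<Longrightarrow> l < length xs \<Longrightarrow> m (xs ! k) (xs ! l) = 2"
    and theta_nonneg: "0 \<le> \<theta>" and theta_sq: "\<theta>\<^sup>2 = of_int p * \<theta> + of_int q"
begin

abbreviation "node \<equiv> (!) xs"

lemma node_closed [simp]: "k < length xs \<Longrightarrow> node k \<in> I"
  using nodes by auto

lemma node_eq_iff: "k < length xs \<Longrightarrow> l < length xs \<Longrightarrow> node k = node l \<longleftrightarrow> k = l"
  using distinct_nodes by (simp add: nth_eq_iff_index_eq)

lemma cartan_node:
  assumes "k < length xs" "l < length xs"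
  shows "- cartan m (node k) (node l) =
    (if k = l then - 2 else if l = Suc k \<or> k = Suc l then (if hs ! min l k then \<theta> else 1) else 0)"
proof -
  have lt: "- cartan m (node k) (node l) = (if l = Suc k then (if hs ! k then \<theta> else 1) else 0)"
    if "k < l" "l < length xs" for k l
    using that adjacent[of k] distant[of k l] length_nodes
    by (cases "l = Suc k") (auto simp: cartan_def)
  have sym: "cartan m (node k) (node l) = cartan m (node l) (node k)"
    using assms label_sym[of "node k" "node l"] by (simp add: cartan_def)
  consider "k = l" | "k < l" | "l < k" by linarith
  then show ?thesis
  proof cases
    case 1
    then show ?thesis using assms by (simp add: cartan_diag label_diag)
  next
    case 2
    then show ?thesis using lt[of k l] assms by (simp add: min_def)
  next
    case 3
    then show ?thesis using lt[of l k] assms unfolding sym by (simp add: min_def)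
  qed
qed

definition represents :: "quad list list \<Rightarrow> 'a \<Rightarrow> bool" where
  "represents C g \<longleftrightarrow> length C = length xs \<and> (\<forall>i < length xs. length (C ! i) = length xs \<and>
     (\<forall>l < length xs. quad_eval \<theta> (C ! i ! l) = gact g (simple_root (node i)) (node l)))"

lemma quad_eval_simps:
  "quad_eval \<theta> (quad_add x y) = quad_eval \<theta> x + quad_eval \<theta> y"
  "quad_eval \<theta> (quad_neg x) = - quad_eval \<theta> x"
  "quad_eval \<theta> (quad_scale p q h x) = (if h then \<theta> else 1) * quad_eval \<theta> x"
proof -
  have "\<theta> * (of_int b * \<theta>) = of_int b * (of_int p * \<theta> + of_int q)" for b
    using theta_sq by (simp add: power2_eq_square)
  then show "quad_eval \<theta> (quad_scale p q h x) = (if h then \<theta> else 1) * quad_eval \<theta> x"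
    by (simp add: quad_eval_def quad_scale_def algebra_simps)
qed (simp_all add: quad_eval_def quad_add_def quad_neg_def algebra_simps)

lemma gact_outside:
  assumes "g \<in> carrier G" "i \<in> I" "k \<notin> I"
  shows "gact g (simple_root i) k = 0"
proof -
  obtain u where u: "u \<in> lists I" "val u = g" using assms(1) carrier_iff by blast
  show ?thesis
    using wact_support[OF u(1) assms(2,3)] gact_val[OF u(1)] unfolding u(2) by simp
qed

lemma represents_signs:
  assumes "represents C g" "g \<in> carrier G" "i < length xs"
  shows "all_nonneg (C ! i) \<Longrightarrow> 0 \<le> gact g (simple_root (node i)) k"
    and "all_nonpos (C ! i) \<Longrightarrow> gact g (simple_root (node i)) k \<le> 0"
proof -
  have *: "gact g (simple_root (node i)) k = 0 \<or>
      (\<exists>l < length (C ! i). gact g (simple_root (node i)) k = quad_eval \<theta> (C ! i ! l))"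
  proof (cases "k \<in> I")
    case True
    then obtain l where "l < length xs" "k = node l" using nodes by (metis in_set_conv_nth)
    then show ?thesis using assms(1,3) unfolding represents_def by metis
  next
    case False
    then show ?thesis using gact_outside[OF assms(2)] assms(3) by simp
  qed
  show "0 \<le> gact g (simple_root (node i)) k" if "all_nonneg (C ! i)"
    using * that theta_nonneg by (auto simp: all_nonneg_def list_all_length quad_eval_def)
  show "gact g (simple_root (node i)) k \<le> 0" if "all_nonpos (C ! i)"
    using * that theta_nonneg
    by (auto simp: all_nonpos_def list_all_length quad_eval_def
        intro!: add_nonpos_nonpos mult_nonpos_nonneg)
qed

lemma represents_one: "represents (simple_roots (length xs)) \<one>"
  by (simp add: represents_def simple_roots_def quad_eval_def simple_root_def node_eq_iff)

lemma represents_step: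
  assumes "represents C g" "g \<in> carrier G" "k < length xs"
  shows "represents (step p q hs k C) (g \<otimes> s (node k))"
proof -
  have C: "length C = length xs" "\<And>i. i < length xs \<Longrightarrow> length (C ! i) = length xs"
    "\<And>i l. i < length xs \<Longrightarrow> l < length xs \<Longrightarrow> quad_eval \<theta> (C ! i ! l) = gact g (simple_root (node i)) (node l)"
    using assms(1) by (auto simp: represents_def)
  have gact: "gact (g \<otimes> s (node k)) (simple_root (node i)) =
      lincomb 1 (gact g (simple_root (node i))) (- cartan m (node k) (node i)) (gact g (simple_root (node k)))"
    if i: "i < length xs" for i
  proof -
    have "reflect I m (node k) (simple_root (node i))
        = lincomb 1 (simple_root (node i)) (- cartan m (node k) (node i)) (simple_root (node k))"
      using i by (auto simp: reflect_def coroot_simple_root finite_index) (auto simp: lincomb_def simple_root_def)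
    then show ?thesis
      using assms i by (simp add: gact_mult simple_closed gact_simple gact_lincomb)
  qed
  show ?thesis
    unfolding represents_def
  proof (intro conjI allI impI)
    fix i l assume i: "i < length xs" and l: "l < length xs"
    show "quad_eval \<theta> (step p q hs k C ! i ! l) = gact (g \<otimes> s (node k)) (simple_root (node i)) (node l)"
      using i l assms(3) C(1,2)
      by (auto simp: step_def gact[OF i] lincomb_def cartan_node quad_eval_simps C(3))
  qed (use assms(3) C in \<open>auto simp: step_def\<close>)
qed

lemma reduced_word_snoc:
  assumes "reduced_word u g" "represents C g" "k < length xs" "all_nonneg (C ! k)"
  shows "reduced_word (u @ [node k]) (g \<otimes> s (node k))"
proof -
  have g: "g \<in> carrier G" using assms(1) by (rule reduced_wordD)
  have len: "len (g \<otimes> s (node k)) = Suc (len g)"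
    using represents_signs(1)[OF assms(2) g assms(3,4)] ascent_iff[OF g] assms(3) by simp
  show ?thesis
    using assms(1,3) len by (auto simp: reduced_word_def val_append simple_closed)
qed

lemma ascend_reduced:
  assumes "ascend p q hs C u = Some C'" "list_all (\<lambda>k. k < length xs) u"
    and "represents C g" "reduced_word u' g"
  shows "\<exists>g'. represents C' g' \<and> reduced_word (u' @ map node u) g'"
  using assms
proof (induction u arbitrary: C g u')
  case Nil
  then show ?case by auto
next
  case (Cons k u)
  have k: "k < length xs" "all_nonneg (C ! k)" and a: "ascend p q hs (step p q hs k C) u = Some C'"
    using Cons.prems by (auto split: if_splits)
  have g: "g \<in> carrier G" using Cons.prems(4) by (rule reduced_wordD)
  have "\<exists>g'. represents C' g' \<and> reduced_word ((u' @ [node k]) @ map node u) g'"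
    using Cons.prems
    by (intro Cons.IH[OF a _ represents_step[OF _ g k(1)] reduced_word_snoc[OF _ _ k]]) auto
  then show ?case by simp
qed

lemma greedy_reduced:
  assumes "list_all (\<lambda>k. k < length xs) u" "represents C g" "reduced_word u' g"
  shows "\<exists>v g'. subseq v (map node u) \<and> represents (greedy p q hs j C u) g' \<and> reduced_word (u' @ v) g'"
  using assms
proof (induction u arbitrary: C g u')
  case Nil
  then show ?case by (intro exI[of _ "[]"] exI[of _ g]) simp
next
  case (Cons k u)
  have g: "g \<in> carrier G" using Cons.prems(3) by (rule reduced_wordD)
  show ?case
  proof (cases "k \<noteq> j \<and> all_nonneg (C ! k)")
    case True
    have k: "k < length xs" "all_nonneg (C ! k)" using Cons.prems True by auto
    have "\<exists>v g'. subseq v (map node u) \<and> represents (greedy p q hs j (step p q hs k C) u) g' \<and>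
        reduced_word ((u' @ [node k]) @ v) g'"
      using Cons.prems
      by (intro Cons.IH[OF _ represents_step[OF _ g k(1)] reduced_word_snoc[OF _ _ k]]) auto
    then obtain v g' where v: "subseq v (map node u)" "represents (greedy p q hs j (step p q hs k C) u) g'"
      "reduced_word ((u' @ [node k]) @ v) g'" by blast
    show ?thesis
      by (rule exI[of _ "node k # v"], rule exI[of _ g']) (use v True in auto)
  next
    case False
    then obtain v g' where v: "subseq v (map node u)" "represents (greedy p q hs j C u) g'"
      "reduced_word (u' @ v) g'"
      using Cons.IH[OF _ Cons.prems(2,3)] Cons.prems(1) by auto
    show ?thesis
      by (rule exI[of _ v], rule exI[of _ g']) (use v False in auto)
  qed
qed

lemma star_eq_empty_certificate:
  assumes fin: "finite (carrier G)" and J: "J\<^sub>1 \<subset> I" "J\<^sub>2 \<subset> I"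
    and cert: "\<And>i. i < length xs \<Longrightarrow> \<exists>w. certificate p q hs i w"
  shows "star J\<^sub>1 J\<^sub>2 = {}"
proof -
  have ex: "\<exists>i < length xs. J \<subseteq> I - {node i}" if "J \<subset> I" for J
  proof -
    obtain a where "a \<in> I - J" using psubset_imp_ex_mem[OF \<open>J \<subset> I\<close>] by blast
    moreover from this obtain i where "i < length xs" "node i = a" using nodes by (metis DiffD1 in_set_conv_nth)
    ultimately show ?thesis using \<open>J \<subset> I\<close> by blast
  qed
  obtain i where i: "i < length xs" "J\<^sub>1 \<subseteq> I - {node i}" using ex[OF J(1)] by blast
  obtain k where k: "k < length xs" "J\<^sub>2 \<subseteq> I - {node k}" using ex[OF J(2)] by blast
  obtain w where w: "certificate p q hs i w" using cert[OF i(1)] by blast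
  note cert = certificateD[OF w length_nodes]
  note w_lt = cert(1) and neg = cert(3)[OF k(1)]
  obtain C where C: "ascend p q hs (simple_roots (length xs)) (rev w) = Some C"
    and C_pos: "\<And>j. j < length xs \<Longrightarrow> j \<noteq> i \<Longrightarrow> all_nonneg (C ! j)"
    using cert(2) by blast
  have one: "reduced_word [] \<one>" by (simp add: reduced_word_def)
  obtain g where g: "represents C g" "reduced_word (map node (rev w)) g"
    using ascend_reduced[OF C _ represents_one one] w_lt by (auto simp: list_all_iff)
  obtain v h where v: "subseq v (map node w)" "reduced_word v h"
    "represents (greedy p q hs k (simple_roots (length xs)) w) h"
    using greedy_reduced[OF w_lt represents_one one, of k] by auto
  have gc: "g \<in> carrier G" and hc: "h \<in> carrier G" using g(2) v(2) by (auto dest: reduced_wordD)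
  have node_ex: "\<exists>l < length xs. j = node l" if "j \<in> I" for j
    using that nodes by (metis in_set_conv_nth)
  show ?thesis
  proof (rule star_eq_empty[OF fin])
    show "J\<^sub>1 \<subseteq> I" "J\<^sub>2 \<subseteq> I" using J by auto
    show "reduced_word (map node w) (inv g)"
      using reduced_word_rev[OF g(2)] by (simp add: rev_map)
    show "reduced_word v h" "subseq v (map node w)" by fact+
  next
    fix j assume j: "j \<in> J\<^sub>1"
    then obtain l where l: "l < length xs" "j = node l" "l \<noteq> i" using i node_ex[of j] by blast
    have "0 \<le> gact g (simple_root j) k" for k
      using represents_signs(1)[OF g(1) gc l(1) C_pos[OF l(1,3)]] unfolding l(2) .
    then have "real (len (s j \<otimes> inv g)) = len (inv g) + 1"
      using left_sign_iff[of "inv g" j 1] gc l by simp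
    then show "len (s j \<otimes> inv g) = Suc (len (inv g))" by linarith
  next
    fix j assume j: "j \<in> J\<^sub>2"
    then obtain l where l: "l < length xs" "j = node l" "l \<noteq> k" using k node_ex[of j] by blast
    have "gact h (simple_root j) k \<le> 0" for k
      using represents_signs(2)[OF v(3) hc l(1) neg[OF l(1,3)]] unfolding l(2) .
    then show "len h = Suc (len (h \<otimes> s j))"
      using descent_iff[of h j] hc l by simp
  qed
qed

end


section \<open>The exceptional and dihedral types\<close>

text \<open>With \<open>x = pi / 5\<close> and \<open>c = cos x\<close> the relation \<open>cos (3 x) = - cos (2 x)\<close> factors as \<open>(c + 1) (4 c\<^sup>2 - 2 c - 1) = 0\<close>.\<close>

lemma golden_ratio:
  defines "\<theta> \<equiv> 2 * cos (pi / 5)"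
  shows "\<theta> \<ge> 0" "\<theta>\<^sup>2 = \<theta> + 1"
proof -
  define c where "c = cos (pi / 5)"
  have c: "c > 0" unfolding c_def by (rule cos_gt_zero_pi) (use pi_gt_zero in linarith)+
  then show "\<theta> \<ge> 0" by (simp add: \<theta>_def c_def)
  have "3 * (pi / 5) = pi - 2 * (pi / 5)" by simp
  then have "cos (3 * (pi / 5)) = - cos (2 * (pi / 5))" by (metis cos_pi_minus)
  then have "4 * c ^ 3 - 3 * c = - (2 * c\<^sup>2 - 1)"
    unfolding cos_treble_cos cos_double_cos c_def .
  then have "(c + 1) * (4 * c\<^sup>2 - 2 * c - 1) = 0" by (simp add: algebra_simps power2_eq_square power3_eq_cube)
  then have "4 * c\<^sup>2 - 2 * c - 1 = 0" using c by auto
  then show "\<theta>\<^sup>2 = \<theta> + 1" by (simp add: \<theta>_def c_def power2_eq_square)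
qed

context coxeter_system
begin

lemma path_label_nonzero:
  assumes "path_diagram ls I m" "\<forall>l\<in>set ls. l \<noteq> 0" "i \<in> I" "j \<in> I"
  shows "m i j \<noteq> 0"
proof -
  obtain xs where xs: "set xs = I" "length xs = Suc (length ls)"
    "\<And>k. k < length ls \<Longrightarrow> m (xs ! k) (xs ! Suc k) = ls ! k"
    "\<And>k l. Suc k < l \<Longrightarrow> l < length xs \<Longrightarrow> m (xs ! k) (xs ! l) = 2"
    using assms(1) unfolding path_diagram_def by blast
  obtain k l where kl: "k < length xs" "i = xs ! k" "l < length xs" "j = xs ! l"
    using assms(3,4) xs(1) by (metis in_set_conv_nth)
  have lt: "m (xs ! a) (xs ! b) \<noteq> 0" if "a < b" "b < length xs" for a b
    using that xs(2) xs(3)[of a] xs(4)[of a b] assms(2) by (cases "b = Suc a") auto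
  show ?thesis
    using lt[of k l] lt[of l k] kl label_sym[OF assms(3,4)] label_diag[OF assms(3)]
    by (cases k l rule: linorder_cases) auto
qed

lemma finite_label:
  assumes "path_diagram ls I m" "\<forall>l\<in>set ls. l \<noteq> 0"
  shows "finite_label_coxeter_system G I s m"
  using path_label_nonzero[OF assms]
  by (intro finite_label_coxeter_system.intro finite_label_coxeter_system_axioms.intro coxeter_system_axioms)

lemma path_star_eq_empty:
  assumes path: "path_diagram ls I m" and ls: "\<forall>l\<in>set ls. l \<noteq> 0"
    and len: "length hs = length ls"
    and cos: "\<And>k. k < length ls \<Longrightarrow> 2 * cos (pi / (ls ! k)) = (if hs ! k then \<theta> else 1)"
    and \<theta>: "0 \<le> \<theta>" "\<theta>\<^sup>2 = of_int p * \<theta> + of_int q"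
    and fin: "finite (carrier G)" and J: "J\<^sub>1 \<subset> I" "J\<^sub>2 \<subset> I"
    and cert: "\<And>i. i < Suc (length ls) \<Longrightarrow> \<exists>w. certificate p q hs i w"
  shows "star J\<^sub>1 J\<^sub>2 = {}"
proof -
  obtain xs where xs: "distinct xs" "set xs = I" "length xs = Suc (length ls)"
    "\<And>k. k < length ls \<Longrightarrow> m (xs ! k) (xs ! Suc k) = ls ! k"
    "\<And>k l. Suc k < l \<Longrightarrow> l < length xs \<Longrightarrow> m (xs ! k) (xs ! l) = 2"
    using path unfolding path_diagram_def by blast
  interpret finite_label_coxeter_system G I s m by (rule finite_label[OF path ls])
  interpret path_coxeter_system G I s m xs hs \<theta> p q
    by unfold_locales (use xs len cos \<theta> in auto)
  show ?thesis
    using star_eq_empty_certificate[OF fin J] cert xs(3) by simp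
qed

lemma star_eq_empty_H3:
  assumes "type_H3 I m" "finite (carrier G)" "J\<^sub>1 \<subset> I" "J\<^sub>2 \<subset> I"
  shows "star J\<^sub>1 J\<^sub>2 = {}"
proof (rule path_star_eq_empty[where hs = "[True, False]" and p = 1 and q = 1 and \<theta> = "2 * cos (pi / 5)"])
  show "path_diagram [5, 3] I m" using assms(1) by (simp add: type_H3_def)
  show "\<exists>w. certificate 1 1 [True, False] i w" if "i < Suc (length [5, 3 :: nat])" for i
    using that by (intro ex_certificate_H3) simp
  show "0 \<le> 2 * cos (pi / 5)" by (rule golden_ratio(1))
  show "(2 * cos (pi / 5))\<^sup>2 = of_int 1 * (2 * cos (pi / 5)) + of_int 1"
    using golden_ratio(2) by simp
  show "finite (carrier G)" "J\<^sub>1 \<subset> I" "J\<^sub>2 \<subset> I" by fact+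
qed (auto simp: less_Suc_eq cos_60)

lemma star_eq_empty_H4:
  assumes "type_H4 I m" "finite (carrier G)" "J\<^sub>1 \<subset> I" "J\<^sub>2 \<subset> I"
  shows "star J\<^sub>1 J\<^sub>2 = {}"
proof (rule path_star_eq_empty[where hs = "[True, False, False]" and p = 1 and q = 1 and \<theta> = "2 * cos (pi / 5)"])
  show "path_diagram [5, 3, 3] I m" using assms(1) by (simp add: type_H4_def)
  show "\<exists>w. certificate 1 1 [True, False, False] i w" if "i < Suc (length [5, 3, 3 :: nat])" for i
    using that by (intro ex_certificate_H4) simp
  show "0 \<le> 2 * cos (pi / 5)" by (rule golden_ratio(1))
  show "(2 * cos (pi / 5))\<^sup>2 = of_int 1 * (2 * cos (pi / 5)) + of_int 1"
    using golden_ratio(2) by simp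
  show "finite (carrier G)" "J\<^sub>1 \<subset> I" "J\<^sub>2 \<subset> I" by fact+
qed (auto simp: less_Suc_eq cos_60)

lemma star_eq_empty_F4:
  assumes "type_F4 I m" "finite (carrier G)" "J\<^sub>1 \<subset> I" "J\<^sub>2 \<subset> I"
  shows "star J\<^sub>1 J\<^sub>2 = {}"
proof (rule path_star_eq_empty[where hs = "[False, True, False]" and p = 0 and q = 2 and \<theta> = "sqrt 2"])
  show "path_diagram [3, 4, 3] I m" using assms(1) by (simp add: type_F4_def)
  show "\<exists>w. certificate 0 2 [False, True, False] i w" if "i < Suc (length [3, 4, 3 :: nat])" for i
    using that by (intro ex_certificate_F4) simp
  show "finite (carrier G)" "J\<^sub>1 \<subset> I" "J\<^sub>2 \<subset> I" by fact+
qed (auto simp: less_Suc_eq cos_60 cos_45)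

text \<open>In the dihedral case the alternating word of length \<open>2\<close> ending in \<open>s\<close> starts with the other generator,
  and prefixing it with \<open>s\<close> gives an alternating word of length \<open>3 \<le> k\<close>, which is reduced.\<close>

lemma star_eq_empty_I2:
  assumes k: "k \<ge> 3" and I2: "type_I2 k I m" and fin: "finite (carrier G)" and J: "J\<^sub>1 \<subset> I" "J\<^sub>2 \<subset> I"
  shows "star J\<^sub>1 J\<^sub>2 = {}"
proof -
  have path: "path_diagram [k] I m" using I2 by (simp add: type_I2_def)
  interpret finite_label_coxeter_system G I s m
    by (rule finite_label[OF path]) (use k in auto)
  obtain xs where xs: "distinct xs" "set xs = I" "length xs = 2" "m (xs ! 0) (xs ! 1) = k"
    using path unfolding path_diagram_def by (auto simp: numeral_2_eq_2)
  then obtain a b where ab: "xs = [a, b]" by (auto simp: length_Suc_conv numeral_2_eq_2)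
  have I: "I = {a, b}" "a \<noteq> b" "m a b = k" using xs by (auto simp: ab)
  then have "m b a = k" using label_sym[of a b] by auto
  obtain i j where ij: "I = {i, j}" "i \<noteq> j" "m i j = k" "J\<^sub>1 \<subseteq> {j}"
  proof (cases "a \<in> J\<^sub>1")
    case True
    then show ?thesis using that[of b a] I J(1) \<open>m b a = k\<close> by blast
  next
    case False
    then show ?thesis using that[of a b] I J(1) by blast
  qed
  obtain c where c: "c \<in> I" "J\<^sub>2 \<subseteq> {c}"
  proof (cases "a \<in> J\<^sub>2")
    case True
    then show ?thesis using that[of a] I J(2) by blast
  next
    case False
    then show ?thesis using that[of b] I J(2) by blast
  qed
  have "m j i = k" using ij label_sym[of i j] by auto
  have ijI: "i \<in> I" "j \<in> I" using ij(1) by auto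
  have len2: "len (val [i, j]) = 2"
    using len_alternating[of i j 2] ij k by (simp add: numeral_2_eq_2)
  have len3: "len (val [j, i, j]) = 3"
    using len_alternating[of j i 3] ij k \<open>m j i = k\<close> by (simp add: numeral_3_eq_3)
  have len1: "len (val [c]) = 1"
    using len_alternating[of c "if c = i then j else i" 1] ij k c \<open>m j i = k\<close> by auto
  have eq1: "val [c] = s c" using c by (simp add: simple_closed)
  show ?thesis
  proof (rule star_eq_empty[OF fin])
    show "J\<^sub>1 \<subseteq> I" "J\<^sub>2 \<subseteq> I" using J by auto
    show "reduced_word [i, j] (val [i, j])" using ijI len2 by (simp add: reduced_word_def)
    show "reduced_word [c] (val [c])" using c len1 by (simp add: reduced_word_def)
    show "subseq [c] [i, j]" using c(1) unfolding ij(1) by (auto simp: subseq_singleton_left)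
    show "len (s l \<otimes> val [i, j]) = Suc (len (val [i, j]))" if "l \<in> J\<^sub>1" for l
    proof -
      have "l = j" using that ij by blast
      then show ?thesis using len2 len3 by simp
    qed
    show "len (val [c]) = Suc (len (val [c] \<otimes> s l))" if "l \<in> J\<^sub>2" for l
    proof -
      have "l = c" using that c by blast
      then show ?thesis using len1 c(1) unfolding eq1 by simp
    qed
  qed
qed

end

theorem mainTheorem8:
  fixes G (structure)
    and I :: "'i set" and s :: "'i \<Rightarrow> 'a" and m :: "'i \<Rightarrow> 'i \<Rightarrow> nat"
    and J\<^sub>1 J\<^sub>2 :: "'i set"
  assumes "coxeter_system G I s m"
    and "finite (carrier G)"
    and "irreducible_matrix I m"
    and "type_F4 I m \<or> type_H3 I m \<or> type_H4 I m \<or> (\<exists>k\<ge>3. type_I2 k I m)"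
    and "J\<^sub>1 \<subset> I" and "J\<^sub>2 \<subset> I"
  shows "coxeter_system.star G I s m J\<^sub>1 J\<^sub>2 = {}"
proof -
  interpret coxeter_system G I s m by fact
  show ?thesis
    using assms(4) star_eq_empty_F4[OF _ assms(2,5,6)] star_eq_empty_H3[OF _ assms(2,5,6)]
      star_eq_empty_H4[OF _ assms(2,5,6)] star_eq_empty_I2[OF _ _ assms(2,5,6)]
    by blast
qed

end
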